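(* Let $G$ be a connected $(n-k)$-regular graph of order $n$, where $1\leq k\leq 4$. Then $rd(G)=n-k$.
   Context: All graphs are simple, finite and undirected. For an edge-coloring of $G$ (adjacent edges may receive the same color), an edge-cut $R$ is a rainbow cut if no two edges of $R$ have the same color; it is a $u$-$v$ rainbow cut if $u$ and $v$ lie in different components of $G-R$. $G$ is rainbow disconnected if every two vertices $u,v$ have a $u$-$v$ rainbow cut. For a nontrivial connected graph $G$, $rd(G)$ is the smallest number of colors in an edge-coloring making $G$ rainbow disconnected. *)

theory Defs
  imports Main
begin

text \<open>A graph is given by its vertex set \<open>V\<close> and its set \<open>E\<close> of two-element edges.\<close>

definition simple_graph :: "'a set \<Rightarrow> 'a set set \<Rightarrow> bool" where
  "simple_graph V E \<longleftrightarrow> finite V \<and> (\<forall>e\<in>E. e \<subseteq> V \<and> card e = 2)"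

definition degree :: "'a set set \<Rightarrow> 'a \<Rightarrow> nat" where
  "degree E v = card {e \<in> E. v \<in> e}"

definition regular :: "nat \<Rightarrow> 'a set \<Rightarrow> 'a set set \<Rightarrow> bool" where
  "regular d V E \<longleftrightarrow> (\<forall>v\<in>V. degree E v = d)"

definition component :: "'a set \<Rightarrow> 'a set set \<Rightarrow> 'a \<Rightarrow> 'a set" where
  "component V E v = {w \<in> V. (v, w) \<in> {(x, y). {x, y} \<in> E}\<^sup>*}"

definition connected_graph :: "'a set \<Rightarrow> 'a set set \<Rightarrow> bool" where
  "connected_graph V E \<longleftrightarrow> V \<noteq> {} \<and> (\<forall>v\<in>V. component V E v = V)"

definition edge_cut :: "'a set \<Rightarrow> 'a set set \<Rightarrow> 'a set set \<Rightarrow> bool" where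
  "edge_cut V E R \<longleftrightarrow> R \<subseteq> E \<and> \<not> connected_graph V (E - R)"

definition rainbow_cut ::
    "'a set \<Rightarrow> 'a set set \<Rightarrow> ('a set \<Rightarrow> nat) \<Rightarrow> 'a set set \<Rightarrow> bool" where
  "rainbow_cut V E c R \<longleftrightarrow> edge_cut V E R \<and> inj_on c R"

definition rainbow_cut_between ::
    "'a set \<Rightarrow> 'a set set \<Rightarrow> ('a set \<Rightarrow> nat) \<Rightarrow> 'a \<Rightarrow> 'a \<Rightarrow> 'a set set \<Rightarrow> bool" where
  "rainbow_cut_between V E c u v R \<longleftrightarrow>
     rainbow_cut V E c R \<and> component V (E - R) u \<noteq> component V (E - R) v"

definition rainbow_disconnected ::
    "'a set \<Rightarrow> 'a set set \<Rightarrow> ('a set \<Rightarrow> nat) \<Rightarrow> bool" where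
  "rainbow_disconnected V E c \<longleftrightarrow>
     (\<forall>u\<in>V. \<forall>v\<in>V. u \<noteq> v \<longrightarrow> (\<exists>R. rainbow_cut_between V E c u v R))"

text \<open>For a finite simple graph the set of admissible \<open>m\<close> is nonempty whenever the graph is
  connected, since colouring all edges differently makes every edge-cut rainbow. For the
  one-vertex graph the value is \<open>0\<close>.\<close>

definition rd :: "'a set \<Rightarrow> 'a set set \<Rightarrow> nat" where
  "rd V E = (LEAST m. \<exists>c :: 'a set \<Rightarrow> nat. c ` E \<subseteq> {1..m} \<and> rainbow_disconnected V E c)"

end

theory Submission
  imports Defs "HOL-Combinatorics.Transposition"
begin

text \<open>
  Write \<open>d = n - k\<close>. Since \<open>k \<le> 4\<close>, every edge-cut of \<open>G\<close> has at least \<open>d\<close> edges, so \<open>d\<close> colours are needed.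
  Conversely it suffices to find a vertex \<open>w\<close> such that \<open>G - w\<close> has a proper edge-colouring with \<open>d\<close>
  colours: an edge \<open>wv\<close> then gets a colour missing at \<open>v\<close>, and the star of every vertex other than
  \<open>w\<close> is a rainbow cut.

  In \<open>G - w\<close> only the \<open>k - 1\<close> non-neighbours of \<open>w\<close> still have degree \<open>d\<close>. Vizing's fan argument colours a
  graph as soon as these saturated vertices are \<open>a, b, c\<close> with \<open>a, b\<close> non-adjacent. This leaves the case
  that \<open>k = 4\<close> and the complement \<open>H\<close> of \<open>G\<close>, which is cubic, has no triangle. There one takes a path \<open>z, a, w, b\<close>
  in \<open>H\<close> and a perfect matching of \<open>G\<close> containing \<open>wz\<close> and \<open>ab\<close> as one colour class; what remains of \<open>G - w\<close> can be
  coloured with \<open>d - 1\<close> colours by fans again. Such a matching exists because a graph of even order whose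
  complement has no triangle has a perfect matching, unless that complement is spanned by a complete
  bipartite graph with two odd sides.
\<close>

subsection \<open>Proper edge-colourings and Vizing fans\<close>

definition proper :: "'a set set \<Rightarrow> ('a set \<Rightarrow> nat) \<Rightarrow> bool" where
  "proper E f \<longleftrightarrow> (\<forall>v. inj_on f {e \<in> E. v \<in> e})"

definition edge_colorable :: "'a set set \<Rightarrow> nat \<Rightarrow> bool" where
  "edge_colorable E D \<longleftrightarrow> (\<exists>f. f ` E \<subseteq> {1..D} \<and> proper E f)"

definition missing :: "nat \<Rightarrow> 'a set set \<Rightarrow> ('a set \<Rightarrow> nat) \<Rightarrow> 'a \<Rightarrow> nat set" where
  "missing D E f v = {1..D} - f ` {e \<in> E. v \<in> e}"

lemma properD:
  "\<lbrakk>proper E f; e \<in> E; e' \<in> E; v \<in> e; v \<in> e'; f e = f e'\<rbrakk> \<Longrightarrow> e = e'"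
  by (auto simp: proper_def dest: inj_onD)

lemma properI:
  "(\<And>v e e'. \<lbrakk>e \<in> E; e' \<in> E; v \<in> e; v \<in> e'; f e = f e'\<rbrakk> \<Longrightarrow> e = e') \<Longrightarrow> proper E f"
  by (auto simp: proper_def inj_on_def)

lemma proper_mono: "proper E f \<Longrightarrow> E' \<subseteq> E \<Longrightarrow> proper E' f"
  by (rule properI) (meson properD subsetD)

lemma missingD: "\<lbrakk>\<alpha> \<in> missing D E f v; e \<in> E; v \<in> e\<rbrakk> \<Longrightarrow> f e \<noteq> \<alpha>"
  by (auto simp: missing_def)

lemma missing_nonempty:
  assumes "finite E" "degree E v < D"
  shows "missing D E f v \<noteq> {}"
proof
  assume "missing D E f v = {}"
  then have "{1..D} \<subseteq> f ` {e \<in> E. v \<in> e}" by (auto simp: missing_def)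
  then have "D \<le> card (f ` {e \<in> E. v \<in> e})"
    using card_mono[of "f ` {e \<in> E. v \<in> e}" "{1..D}"] assms(1) by simp
  also have "\<dots> \<le> degree E v"
    unfolding degree_def using assms(1) by (intro card_image_le) auto
  finally show False using assms(2) by simp
qed

lemma proper_extend:
  assumes "proper (E - {e}) f" "\<And>v e'. \<lbrakk>v \<in> e; e' \<in> E - {e}; v \<in> e'\<rbrakk> \<Longrightarrow> f e' \<noteq> \<alpha>"
  shows "proper E (f(e := \<alpha>))"
proof (rule properI)
  fix v e1 e2
  assume *: "e1 \<in> E" "e2 \<in> E" "v \<in> e1" "v \<in> e2" "(f(e := \<alpha>)) e1 = (f(e := \<alpha>)) e2"
  show "e1 = e2"
  proof (cases "e1 = e \<or> e2 = e")
    case True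
    then show ?thesis using * assms(2)[of v] by (auto split: if_splits)
  next
    case False
    then show ?thesis using * properD[OF assms(1), of e1 e2 v] by auto
  qed
qed

text \<open>\<open>{x, y 0}\<close> is uncoloured. It may take \<open>m 0\<close>, the colour of
  \<open>{x, y 1}\<close>, which then becomes the uncoloured edge of the shorter fan
  \<open>y \<circ> Suc\<close>. Rotating on, the last edge takes \<open>m k\<close>, which is free
  at both of its ends.\<close>

lemma fan_shift:
  assumes card2: "\<forall>e\<in>E. card e = 2"
  shows "\<lbrakk>proper (E - {{x, y 0}}) f; f ` (E - {{x, y 0}}) \<subseteq> {1..D}; inj_on y {..k};
    \<forall>i\<le>k. {x, y i} \<in> E; \<forall>i<k. f {x, y (Suc i)} = m i;
    \<forall>i\<le>k. m i \<in> missing D (E - {{x, y 0}}) f (y i);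
    m k \<in> missing D (E - {{x, y 0}}) f x\<rbrakk> \<Longrightarrow> edge_colorable E D"
proof (induction k arbitrary: y m f)
  case 0
  let ?f = "f({x, y 0} := m 0)"
  have "proper E ?f"
  proof (rule proper_extend[OF 0(1)])
    fix v e' assume "v \<in> {x, y 0}" "e' \<in> E - {{x, y 0}}" "v \<in> e'"
    then show "f e' \<noteq> m 0" using 0(6,7) by (auto dest: missingD)
  qed
  moreover have "?f ` E \<subseteq> {1..D}" using 0(2,7) by (auto simp: missing_def)
  ultimately show ?case unfolding edge_colorable_def by blast
next
  case (Suc k)
  let ?E1 = "E - {{x, y 0}}" and ?E2 = "E - {{x, y (Suc 0)}}"
  let ?f = "f({x, y 0} := m 0)"
  have ne: "x \<noteq> y i" if "i \<le> Suc k" for i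
    using that Suc.prems(4) card2 by fastforce
  have y01: "y i \<noteq> y 0" if "0 < i" "i \<le> Suc k" for i
    using that inj_onD[OF Suc.prems(3), of i 0] by auto
  have e01: "{x, y i} \<noteq> {x, y 0}" if "0 < i" "i \<le> Suc k" for i
    using y01[OF that] by (metis doubleton_eq_iff)
  have col1: "f {x, y (Suc 0)} = m 0" using Suc.prems(5) by simp
  have in1: "{x, y (Suc 0)} \<in> ?E1" using Suc.prems(4) e01[of "Suc 0"] by simp
  show ?case
  proof (rule Suc.IH[of "y \<circ> Suc" ?f "m \<circ> Suc"])
    have "proper ?E2 ?f"
    proof (rule proper_extend)
      show "proper (?E2 - {{x, y 0}}) f" by (rule proper_mono[OF Suc.prems(1)]) auto
      fix v e' assume *: "v \<in> {x, y 0}" "e' \<in> ?E2 - {{x, y 0}}" "v \<in> e'"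
      show "f e' \<noteq> m 0"
      proof (cases "v = x")
        case True
        then show ?thesis using * col1 in1 properD[OF Suc.prems(1), of e' "{x, y (Suc 0)}" x] by auto
      next
        case False
        then show ?thesis using * Suc.prems(6) by (auto dest: missingD)
      qed
    qed
    then show "proper (E - {{x, (y \<circ> Suc) 0}}) ?f" by simp
    have "m 0 \<in> {1..D}" using Suc.prems(6) by (auto simp: missing_def)
    then show "?f ` (E - {{x, (y \<circ> Suc) 0}}) \<subseteq> {1..D}" using Suc.prems(2) by auto
    show "inj_on (y \<circ> Suc) {..k}" using Suc.prems(3) by (auto simp: inj_on_def)
    show "\<forall>i\<le>k. {x, (y \<circ> Suc) i} \<in> E" using Suc.prems(4) by auto
    show "\<forall>i<k. ?f {x, (y \<circ> Suc) (Suc i)} = (m \<circ> Suc) i"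
      using Suc.prems(5) e01 by auto
    show "\<forall>i\<le>k. (m \<circ> Suc) i \<in> missing D (E - {{x, (y \<circ> Suc) 0}}) ?f ((y \<circ> Suc) i)"
    proof (intro allI impI)
      fix i assume "i \<le> k"
      then have i: "m (Suc i) \<in> missing D ?E1 f (y (Suc i))" using Suc.prems(6) by auto
      have "y (Suc i) \<notin> {x, y 0}" using ne[of "Suc i"] y01[of "Suc i"] \<open>i \<le> k\<close> by auto
      then show "(m \<circ> Suc) i \<in> missing D (E - {{x, (y \<circ> Suc) 0}}) ?f ((y \<circ> Suc) i)"
        using i by (auto simp: missing_def image_iff)
    qed
    \<comment> \<open>The recoloured edge meets \<open>x\<close>, so the last colour must differ
      from \<open>m 0\<close> to stay free there. It does, since \<open>m 0\<close> already occurred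
      at \<open>x\<close> on \<open>{x, y 1}\<close>.\<close>
    have "m (Suc k) \<noteq> m 0"
      using Suc.prems(7) in1 col1 by (metis insertI1 missingD)
    then show "(m \<circ> Suc) k \<in> missing D (E - {{x, (y \<circ> Suc) 0}}) ?f x"
      using Suc.prems(7) by (auto simp: missing_def image_iff)
  qed
qed

section \<open>Two-coloured subgraphs and Kempe exchanges\<close>

lemma degree_zero: "\<lbrakk>finite E; degree E v = 0; e \<in> E\<rbrakk> \<Longrightarrow> v \<notin> e"
  by (auto simp: degree_def)

lemma degree_remove:
  assumes "finite E" "e \<in> E" "v \<in> e"
  shows "degree E v = Suc (degree (E - {e}) v)"
proof -
  have "{e' \<in> E. v \<in> e'} = insert e {e' \<in> E - {e}. v \<in> e'}" using assms by auto
  then show ?thesis using assms(1) by (simp add: degree_def)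
qed

lemma degree_mono: "\<lbrakk>finite E; E' \<subseteq> E\<rbrakk> \<Longrightarrow> degree E' v \<le> degree E v"
  unfolding degree_def by (intro card_mono) auto

text \<open>In the subgraph of two colours every component is a path or a cycle, so at most two vertices of
  degree at most one lie in the same component.\<close>

lemma three_path_ends_separate:
  assumes "finite Q" "\<forall>e\<in>Q. card e = 2" "\<forall>v. degree Q v \<le> 2"
    and "x \<noteq> y" "x \<noteq> z" "y \<noteq> z" "degree Q x \<le> 1" "degree Q y \<le> 1" "degree Q z \<le> 1"
  shows "\<exists>K. (\<forall>e\<in>Q. e \<inter> K \<noteq> {} \<longrightarrow> e \<subseteq> K) \<and> x \<notin> K \<and> (y \<in> K \<or> z \<in> K)"
  using assms
proof (induction Q arbitrary: x rule: finite_psubset_induct)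
  case (psubset Q)
  show ?case
  proof (cases "degree Q x = 0")
    case True
    then show ?thesis using psubset.prems psubset.hyps
      by (intro exI[of _ "- {x}"]) (auto dest!: degree_zero)
  next
    case False
    then obtain e where e: "e \<in> Q" "x \<in> e"
      by (metis (mono_tags, lifting) card.empty degree_def empty_Collect_eq)
    then obtain x' where x': "e = {x, x'}" "x \<noteq> x'"
      using psubset.prems(1) by (fastforce simp: card_2_iff)
    \<comment> \<open>Walk along the path from \<open>x\<close>: once its end edge is deleted,
      \<open>x\<close> is isolated and the other end \<open>x'\<close> takes over its role. The set
      \<open>K\<close> sought is a union of components.\<close>
    let ?Q = "Q - {e}"
    have fin: "finite ?Q" using psubset.hyps by simp
    have sub: "?Q \<subset> Q" using e by blast
    have dx: "degree ?Q x = 0"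
      using degree_remove[OF psubset.hyps e] psubset.prems by simp
    have dx': "degree Q x' = Suc (degree ?Q x')"
      using degree_remove[OF psubset.hyps e(1)] x' by simp
    have le: "degree ?Q v \<le> degree Q v" for v
      using psubset.hyps by (intro degree_mono) auto
    have nx: "x \<notin> e'" if "e' \<in> ?Q" for e' using degree_zero[OF fin dx that] .
    show ?thesis
    proof (cases "x' = y \<or> x' = z")
      case True
      \<comment> \<open>The path is the single edge \<open>e\<close>, so whichever of
        \<open>y\<close>, \<open>z\<close> is not \<open>x'\<close> lies off it.\<close>
      then have "degree ?Q x' = 0" using dx' psubset.prems by auto
      then have nx': "x' \<notin> e'" if "e' \<in> ?Q" for e' using degree_zero[OF fin _ that] by simp
      have "\<forall>e'\<in>Q. e' \<inter> - {x, x'} \<noteq> {} \<longrightarrow> e' \<subseteq> - {x, x'}"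
      proof (intro ballI impI)
        fix e' assume "e' \<in> Q" "e' \<inter> - {x, x'} \<noteq> {}"
        then have "e' \<in> ?Q" using x' by auto
        then show "e' \<subseteq> - {x, x'}" using nx nx' by blast
      qed
      then show ?thesis using True psubset.prems by (intro exI[of _ "- {x, x'}"]) auto
    next
      case False
      have "\<exists>K. (\<forall>e\<in>?Q. e \<inter> K \<noteq> {} \<longrightarrow> e \<subseteq> K) \<and> x' \<notin> K \<and> (y \<in> K \<or> z \<in> K)"
      proof (rule psubset.IH[OF sub])
        show "\<forall>e\<in>?Q. card e = 2" using psubset.prems(1) by blast
        show "\<forall>v. degree ?Q v \<le> 2" using psubset.prems(2) le order_trans by blast
        show "x' \<noteq> y" "x' \<noteq> z" "y \<noteq> z" using False psubset.prems by auto
        show "degree ?Q x' \<le> 1" using dx' psubset.prems(2) by (metis Suc_1 Suc_le_mono)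
        show "degree ?Q y \<le> 1" "degree ?Q z \<le> 1" using le psubset.prems order_trans by blast+
      qed
      then obtain K where K: "\<And>e. e \<in> ?Q \<Longrightarrow> e \<inter> K \<noteq> {} \<Longrightarrow> e \<subseteq> K" "x' \<notin> K" "y \<in> K \<or> z \<in> K"
        by blast
      \<comment> \<open>\<open>x\<close> is isolated in \<open>?Q\<close>, and \<open>e\<close>
        avoids \<open>K - {x}\<close> because \<open>x'\<close> is not in \<open>K\<close>.\<close>
      have "\<forall>e'\<in>Q. e' \<inter> (K - {x}) \<noteq> {} \<longrightarrow> e' \<subseteq> K - {x}"
      proof (intro ballI impI)
        fix e' assume a: "e' \<in> Q" "e' \<inter> (K - {x}) \<noteq> {}"
        then have "e' \<in> ?Q" using x' K(2) by auto
        then show "e' \<subseteq> K - {x}" using nx K(1)[of e'] a by blast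
      qed
      then show ?thesis using K psubset.prems by (intro exI[of _ "K - {x}"]) auto
    qed
  qed
qed

text \<open>The exchange acts on a vertex set \<open>K\<close> that will be closed under the edges
  of both colours; it may be a union of several Kempe chains rather than a single one.\<close>

definition kempe_swap :: "'a set \<Rightarrow> nat \<Rightarrow> nat \<Rightarrow> ('a set \<Rightarrow> nat) \<Rightarrow> 'a set \<Rightarrow> nat" where
  "kempe_swap K \<alpha> \<beta> f e = (if e \<subseteq> K then transpose \<alpha> \<beta> (f e) else f e)"

context
  fixes E :: "'a set set" and f :: "'a set \<Rightarrow> nat" and K \<alpha> \<beta>
  assumes closed: "\<forall>e\<in>{e \<in> E. f e = \<alpha> \<or> f e = \<beta>}. e \<inter> K \<noteq> {} \<longrightarrow> e \<subseteq> K"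
begin

text \<open>An edge leaving \<open>K\<close> has neither of the two colours, so the transposition
  fixes its colour anyway.\<close>

lemma kempe_swap_inside: "\<lbrakk>e \<in> E; v \<in> e; v \<in> K\<rbrakk> \<Longrightarrow> kempe_swap K \<alpha> \<beta> f e = transpose \<alpha> \<beta> (f e)"
  using closed by (cases "f e = \<alpha> \<or> f e = \<beta>") (auto simp: kempe_swap_def)

lemma kempe_swap_outside: "\<lbrakk>v \<in> e; v \<notin> K\<rbrakk> \<Longrightarrow> kempe_swap K \<alpha> \<beta> f e = f e"
  by (auto simp: kempe_swap_def)

lemma proper_kempe_swap:
  assumes "proper E f"
  shows "proper E (kempe_swap K \<alpha> \<beta> f)"
proof (rule properI)
  fix v e e'
  assume *: "e \<in> E" "e' \<in> E" "v \<in> e" "v \<in> e'" "kempe_swap K \<alpha> \<beta> f e = kempe_swap K \<alpha> \<beta> f e'"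
  then have "f e = f e'"
    by (cases "v \<in> K")
      (auto simp: kempe_swap_inside kempe_swap_outside dest: transpose_eq_imp_eq)
  then show "e = e'" using * properD[OF assms] by blast
qed

lemma missing_kempe_swap_outside: "v \<notin> K \<Longrightarrow> missing D E (kempe_swap K \<alpha> \<beta> f) v = missing D E f v"
  unfolding missing_def
  by (intro arg_cong2[where f = minus] image_cong) (auto simp: kempe_swap_outside)

lemma missing_kempe_swap_other:
  assumes "\<gamma> \<in> missing D E f v" "\<gamma> \<noteq> \<alpha>" "\<gamma> \<noteq> \<beta>"
  shows "\<gamma> \<in> missing D E (kempe_swap K \<alpha> \<beta> f) v"
proof -
  have "kempe_swap K \<alpha> \<beta> f e \<noteq> \<gamma>" if "e \<in> E" "v \<in> e" for e
    using missingD[OF assms(1) that] assms(2,3)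
    by (auto simp: kempe_swap_def transpose_def)
  then show ?thesis using assms(1) by (auto simp: missing_def)
qed

lemma missing_kempe_swap_inside:
  assumes "\<alpha> \<in> missing D E f v" "v \<in> K" "\<beta> \<in> {1..D}"
  shows "\<beta> \<in> missing D E (kempe_swap K \<alpha> \<beta> f) v"
proof -
  have "\<beta> \<noteq> kempe_swap K \<alpha> \<beta> f e" if "e \<in> E" "v \<in> e" for e
    using missingD[OF assms(1) that] kempe_swap_inside[OF that assms(2)]
    by (auto simp: transpose_def)
  then show ?thesis using assms(3) by (auto simp: missing_def)
qed

lemma kempe_swap_range:
  assumes "f ` E \<subseteq> {1..D}" "\<alpha> \<in> {1..D}" "\<beta> \<in> {1..D}"
  shows "kempe_swap K \<alpha> \<beta> f ` E \<subseteq> {1..D}"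
  using assms by (auto simp: kempe_swap_def transpose_def)

end

section \<open>Fans, and graphs with few saturated vertices\<close>

lemma edge_other_end: "\<lbrakk>card e = 2; x \<in> e\<rbrakk> \<Longrightarrow> \<exists>z. e = {x, z} \<and> x \<noteq> z"
  by (auto simp: card_2_iff)

text \<open>In a proper colouring each colour occurs at most once at \<open>v\<close>, and a missing
  colour not at all.\<close>

lemma degree_two_colors_le:
  assumes "finite E" "proper E f"
  shows "degree {e \<in> E. f e = \<alpha> \<or> f e = \<beta>} v \<le> 2"
    and "\<alpha> \<in> missing D E f v \<or> \<beta> \<in> missing D E f v \<Longrightarrow> degree {e \<in> E. f e = \<alpha> \<or> f e = \<beta>} v \<le> 1"
proof -
  let ?S = "{e \<in> {e \<in> E. f e = \<alpha> \<or> f e = \<beta>}. v \<in> e}"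
  have inj: "inj_on f ?S" using assms(2) by (auto simp: proper_def inj_on_def)
  have "card (f ` ?S) \<le> card {\<alpha>, \<beta>}" by (intro card_mono) auto
  also have "\<dots> \<le> 2" by (simp add: card_insert_if)
  finally show "degree {e \<in> E. f e = \<alpha> \<or> f e = \<beta>} v \<le> 2"
    unfolding degree_def card_image[OF inj] .
  assume "\<alpha> \<in> missing D E f v \<or> \<beta> \<in> missing D E f v"
  then have "f ` ?S \<subseteq> {\<beta>} \<or> f ` ?S \<subseteq> {\<alpha>}" by (auto dest: missingD)
  then obtain \<gamma> where "f ` ?S \<subseteq> {\<gamma>}" by blast
  then have "card (f ` ?S) \<le> card {\<gamma>}" by (intro card_mono) auto
  then have "card (f ` ?S) \<le> 1" by simp
  then show "degree {e \<in> E. f e = \<alpha> \<or> f e = \<beta>} v \<le> 1"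
    unfolding degree_def card_image[OF inj] .
qed

text \<open>Vizing's fan argument. The fan at \<open>x\<close> never gets stuck because all neighbours of \<open>x\<close> miss
  a colour.\<close>

lemma edge_colorable_insert:
  assumes fin: "finite E" and card2: "\<forall>e\<in>E. card e = 2" and xy: "{x, y} \<in> E"
    and dx: "degree E x \<le> D"
    and dz: "\<And>z. {x, z} \<in> E \<Longrightarrow> degree (E - {{x, y}}) z < D"
    and col: "edge_colorable (E - {{x, y}}) D"
  shows "edge_colorable E D"
proof -
  let ?E = "E - {{x, y}}"
  obtain f where f: "f ` ?E \<subseteq> {1..D}" "proper ?E f"
    using col by (auto simp: edge_colorable_def)
  have finE: "finite ?E" using fin by simp
  have ne: "x \<noteq> z" if "{x, z} \<in> E" for z using that card2 by fastforce
  define m where "m z = (SOME \<alpha>. \<alpha> \<in> missing D ?E f z)" for z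
  have m: "m z \<in> missing D ?E f z" if "{x, z} \<in> E" for z
    unfolding m_def using missing_nonempty[OF finE dz[OF that]] by (simp add: some_in_eq)
  have "degree ?E x < D" using degree_remove[OF fin xy, of x] dx by simp
  then obtain \<beta> where \<beta>: "\<beta> \<in> missing D ?E f x" using missing_nonempty[OF finE] by blast
  \<comment> \<open>A fan has \<open>k + 1\<close> leaves and starts at the uncoloured edge; each
    further edge carries the colour chosen as missing at the leaf before it.\<close>
  define fan where "fan k u \<longleftrightarrow> u 0 = y \<and> inj_on u {..k} \<and> (\<forall>i\<le>k. {x, u i} \<in> E) \<and>
    (\<forall>i<k. f {x, u (Suc i)} = m (u i))" for k :: nat and u
  have finN: "finite {z. {x, z} \<in> E}"
  proof (rule finite_subset)
    show "{z. {x, z} \<in> E} \<subseteq> \<Union>E" by auto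
    show "finite (\<Union>E)" using fin card2 by (metis card.infinite finite_Union zero_neq_numeral)
  qed
  have bound: "k \<le> card {z. {x, z} \<in> E}" if "fan k u" for k u
  proof -
    have "card (u ` {..k}) \<le> card {z. {x, z} \<in> E}"
      using that by (intro card_mono finN) (auto simp: fan_def)
    then show ?thesis using that by (simp add: fan_def card_image)
  qed
  have "fan 0 (\<lambda>_. y)" using xy by (simp add: fan_def)
  \<comment> \<open>Distinct leaves are distinct neighbours of \<open>x\<close>, so there is a
    longest fan.\<close>
  then obtain k where k: "\<exists>u. fan k u" "\<And>k'. \<exists>u. fan k' u \<Longrightarrow> k' \<le> k"
    using bound Nat.ex_has_greatest_nat[of "\<lambda>k. \<exists>u. fan k u" 0 "card {z. {x, z} \<in> E}"] by blast
  then obtain u where u: "fan k u" by blast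
  have u0: "u 0 = y" and inj: "inj_on u {..k}" and uE: "\<And>i. i \<le> k \<Longrightarrow> {x, u i} \<in> E"
    and uf: "\<And>i. i < k \<Longrightarrow> f {x, u (Suc i)} = m (u i)"
    using u by (auto simp: fan_def)
  let ?\<alpha> = "m (u k)"
  have shift: "edge_colorable E D"
    if "j \<le> k" "proper ?E g" "g ` ?E \<subseteq> {1..D}" "\<And>i. i < j \<Longrightarrow> g {x, u (Suc i)} = c i"
      "\<And>i. i \<le> j \<Longrightarrow> c i \<in> missing D ?E g (u i)" "c j \<in> missing D ?E g x" for j g c
  proof (rule fan_shift[OF card2, where y = u and k = j and m = c])
    show "inj_on u {..j}" using inj that(1) by (auto intro: inj_on_subset)
  qed (use that u0 uE in auto)
  show ?thesis
  proof (cases "\<exists>j\<le>k. m (u j) \<in> missing D ?E f x")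
    case True
    then obtain j where "j \<le> k" "m (u j) \<in> missing D ?E f x" by blast
    then show ?thesis using shift[of j f "\<lambda>i. m (u i)"] f uf uE m by simp
  next
    case False
    have \<alpha>D: "?\<alpha> \<in> {1..D}" using m[OF uE[of k]] by (simp add: missing_def)
    have \<beta>D: "\<beta> \<in> {1..D}" using \<beta> by (simp add: missing_def)
    \<comment> \<open>The colour missing at the last leaf occurs at \<open>x\<close>. Its edge
      cannot lengthen the longest fan, so it ends at an earlier leaf \<open>u (Suc i)\<close>,
      whence \<open>m (u i) = ?\<alpha>\<close>.\<close>
    have "?\<alpha> \<in> f ` {e \<in> ?E. x \<in> e}" using False \<alpha>D by (auto simp: missing_def)
    then obtain e where e: "e \<in> ?E" "x \<in> e" "f e = ?\<alpha>"
      by (metis (no_types, lifting) imageE mem_Collect_eq)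
    obtain z where z: "e = {x, z}" using e card2 edge_other_end[of e x] by auto
    have "z \<in> u ` {..k}"
    proof (rule ccontr)
      assume z': "z \<notin> u ` {..k}"
      have "fan (Suc k) (u(Suc k := z))"
        unfolding fan_def
      proof (intro conjI allI impI)
        show "inj_on (u(Suc k := z)) {..Suc k}"
          using inj z' by (auto simp: atMost_Suc inj_on_def)
      qed (use u0 uE uf e z in \<open>auto simp: less_Suc_eq le_Suc_eq\<close>)
      then show False using k(2)[of "Suc k"] by auto
    qed
    then obtain j where j: "j \<le> k" "z = u j" by auto
    have "j \<noteq> 0" using e z j u0 by auto
    then obtain i where i: "j = Suc i" by (cases j) auto
    have "j \<noteq> k" using m[OF uE[of k]] e z j by (auto dest: missingD)
    have ik: "i < k" using i j by simp
    have \<alpha>i: "m (u i) = ?\<alpha>" using uf[OF ik] e(3) z j i by simp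
    have only: "l = i" if "l < k" "m (u l) = ?\<alpha>" for l
    proof -
      have "{x, u (Suc l)} \<in> ?E"
        using uE[of "Suc l"] that(1) u0 inj_onD[OF inj, of "Suc l" 0] by (auto simp: doubleton_eq_iff)
      then have "{x, u (Suc l)} = {x, u j}"
        using properD[OF f(2), of "{x, u (Suc l)}" e x] e z j uf[of l] that by simp
      then have "u (Suc l) = u j" by (metis doubleton_eq_iff)
      then show ?thesis using inj_onD[OF inj, of "Suc l" j] that(1) j i by simp
    qed
    have noth: "m (u l) \<noteq> \<beta>" if "l \<le> k" for l using False \<beta> that by auto
    \<comment> \<open>\<open>x\<close> misses \<open>\<beta>\<close> while \<open>u i\<close> and
      \<open>u k\<close> miss \<open>?\<alpha>\<close>, so all three have degree at most one in
      \<open>?Q\<close>. Hence some union of components contains \<open>u i\<close> or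
      \<open>u k\<close> but not \<open>x\<close>.\<close>
    let ?Q = "{e \<in> ?E. f e = ?\<alpha> \<or> f e = \<beta>}"
    have "u i \<noteq> u k" using inj_onD[OF inj, of i k] ik by auto
    moreover have "x \<noteq> u i" "x \<noteq> u k" using ne uE ik by auto
    moreover have "degree ?Q x \<le> 1"
      using degree_two_colors_le(2)[OF finE f(2)] \<beta> by blast
    moreover have "?\<alpha> \<in> missing D ?E f (u i)" "?\<alpha> \<in> missing D ?E f (u k)"
      using m[OF uE[of i]] m[OF uE[of k]] \<alpha>i ik by simp_all
    then have "degree ?Q (u i) \<le> 1" "degree ?Q (u k) \<le> 1"
      using degree_two_colors_le(2)[OF finE f(2)] by blast+
    ultimately obtain K where K: "\<forall>e\<in>?Q. e \<inter> K \<noteq> {} \<longrightarrow> e \<subseteq> K" "x \<notin> K" "u i \<in> K \<or> u k \<in> K"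
      using three_path_ends_separate[of ?Q x "u i" "u k"] finE card2
        degree_two_colors_le(1)[OF finE f(2)] by auto
    let ?g = "kempe_swap K ?\<alpha> \<beta> f"
    have g: "proper ?E ?g" "?g ` ?E \<subseteq> {1..D}"
      using proper_kempe_swap[OF K(1) f(2)] kempe_swap_range[OF K(1) f(1) \<alpha>D \<beta>D] by auto
    have gx: "?g {x, v} = f {x, v}" for v using K(2) by (simp add: kempe_swap_def)
    have \<beta>x: "\<beta> \<in> missing D ?E ?g x"
      using missing_kempe_swap_outside[OF K(1,2)] \<beta> by simp
    have other: "m (u l) \<in> missing D ?E ?g (u l)" if "l < k" "l \<noteq> i" for l
      using missing_kempe_swap_other[OF K(1) m[OF uE[of l]]] that noth[of l] only[of l] by auto
    show ?thesis
    proof (cases "u i \<in> K")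
      case True
      \<comment> \<open>After the exchange \<open>\<beta>\<close> is free at \<open>u i\<close> and
        still at \<open>x\<close>, so the prefix ending in \<open>u i\<close> can be
        rotated.\<close>
      have "\<beta> \<in> missing D ?E ?g (u i)"
        using missing_kempe_swap_inside[OF K(1) _ True \<beta>D] m[OF uE[of i]] \<alpha>i ik by simp
      then show ?thesis
        using shift[of i ?g "\<lambda>l. if l = i then \<beta> else m (u l)"] g gx \<beta>x other ik uf by auto
    next
      case False
      \<comment> \<open>Now \<open>u k\<close> gains \<open>\<beta>\<close>, while
        \<open>u i\<close> still misses \<open>?\<alpha>\<close>, the colour of the next fan edge;
        the whole fan can be rotated.\<close>
      then have "\<beta> \<in> missing D ?E ?g (u k)"
        using missing_kempe_swap_inside[OF K(1) _ _ \<beta>D] m[OF uE[of k]] K(3) by simp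
      moreover have "m (u i) \<in> missing D ?E ?g (u i)"
        using missing_kempe_swap_outside[OF K(1) False] m[OF uE[of i]] ik by simp
      ultimately show ?thesis
        using shift[of k ?g "\<lambda>l. if l = k then \<beta> else m (u l)"] g gx \<beta>x other uf
        by (metis (no_types, lifting) le_neq_implies_less less_irrefl order_refl)
    qed
  qed
qed

lemma edge_colorable_empty: "edge_colorable {} D"
  by (simp add: edge_colorable_def proper_def)

lemma degree_pos: "\<lbrakk>finite E; e \<in> E; v \<in> e\<rbrakk> \<Longrightarrow> 0 < degree E v"
  by (auto simp: degree_def card_gt_0_iff)

text \<open>The vertices \<open>a, b, c\<close> need not be distinct. The edges at \<open>a\<close>, then those at \<open>b\<close>, then those at
  \<open>c\<close>, are peeled off.\<close>

lemma edge_colorable_path_core: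
  assumes "finite E" "\<forall>e\<in>E. card e = 2" "\<And>v. degree E v \<le> D"
    and "\<And>v. degree E v = D \<Longrightarrow> v \<in> {a, b, c}" "{a, b} \<notin> E"
  shows "edge_colorable E D"
  using assms
proof (induction E rule: finite_psubset_induct)
  case (psubset E)
  note fin = psubset.hyps and card2 = psubset.prems(1) and le = psubset.prems(2)
    and sat = psubset.prems(3) and ab = psubset.prems(4)
  have lt: "degree E v < D" if "v \<notin> {a, b, c}" for v
    using le[of v] sat[of v] that by fastforce
  have IH: "edge_colorable (E - {e}) D" if "e \<in> E" for e
  proof (rule psubset.IH)
    have *: "degree (E - {e}) v \<le> degree E v" for v by (rule degree_mono[OF fin]) auto
    show "degree (E - {e}) v \<le> D" for v using *[of v] le[of v] by simp
    show "v \<in> {a, b, c}" if "degree (E - {e}) v = D" for v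
      using that *[of v] le[of v] sat[of v] by simp
  qed (use that card2 ab in auto)
  have ne: "x \<noteq> z" if "{x, z} \<in> E" for x z using that card2 by fastforce
  \<comment> \<open>\<open>y\<close> is exempt from the degree condition, since deleting
    \<open>{x, y}\<close> lowers its degree.\<close>
  have peel: ?case if xy: "{x, y} \<in> E" and z: "\<And>z. {x, z} \<in> E \<Longrightarrow> z \<noteq> y \<Longrightarrow> degree E z < D" for x y
  proof (rule edge_colorable_insert[OF fin card2 xy le _ IH[OF xy]])
    fix z assume "{x, z} \<in> E"
    show "degree (E - {{x, y}}) z < D"
    proof (cases "z = y")
      case True
      then show ?thesis using degree_remove[OF fin xy, of y] le[of y] by simp
    next
      case False
      then show ?thesis
        using z[OF \<open>{x, z} \<in> E\<close>] degree_mono[OF fin Diff_subset[of E "{{x, y}}"], of z] by simp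
    qed
  qed
  have edge_at: "\<exists>y. {x, y} \<in> E" if "degree E x \<noteq> 0" for x
  proof -
    have "{e \<in> E. x \<in> e} \<noteq> {}" using that unfolding degree_def by (metis card.empty)
    then obtain e where e: "e \<in> E" "x \<in> e" by blast
    then show ?thesis using card2 edge_other_end[of e x] by auto
  qed
  have isolated: "{x, y} \<notin> E" if "degree E x = 0 \<or> degree E y = 0" for x y
    using that degree_pos[OF fin] by (metis insertCI less_irrefl)
  \<comment> \<open>Only \<open>c\<close> can be a saturated neighbour of \<open>x\<close>, so the
    edge to \<open>c\<close> is the one removed if it exists.\<close>
  have lead: ?case if "degree E x \<noteq> 0" "\<And>z. {x, z} \<in> E \<Longrightarrow> z \<noteq> c \<Longrightarrow> z \<notin> {a, b, c}" for x
  proof (cases "{x, c} \<in> E")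
    case True
    then show ?thesis using peel[of x c] that(2) lt by blast
  next
    case False
    obtain y where "{x, y} \<in> E" using edge_at[OF \<open>degree E x \<noteq> 0\<close>] by blast
    then show ?thesis using peel[of x y] that(2) lt False by metis
  qed
  show ?case
  proof (cases "E = {}")
    case True
    then show ?thesis by (simp add: edge_colorable_empty)
  next
    case False
    consider "degree E a \<noteq> 0" | "degree E a = 0" "degree E b \<noteq> 0"
      | "degree E a = 0" "degree E b = 0" by blast
    then show ?thesis
    proof cases
      case 1
      then show ?thesis using lead[of a] ne[of a a] ab by blast
    next
      case 2
      then show ?thesis using lead[of b] ne[of b b] isolated[of b a] by blast
    next
      case 3
      show ?thesis
      proof (cases "degree E c = 0")
        case True
        obtain e where "e \<in> E" using \<open>E \<noteq> {}\<close> by blast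
        then obtain x y where "{x, y} \<in> E" using card2 by (metis card_2_iff)
        then have "degree E x \<noteq> 0" using degree_pos[OF fin, of "{x, y}" x] by simp
        then show ?thesis using lead[of x] isolated[of x] 3 True by blast
      next
        case False
        then show ?thesis using lead[of c] ne[of c c] isolated[of c] 3 by blast
      qed
    qed
  qed
qed

subsection \<open>Perfect matchings\<close>

definition matching :: "'a set set \<Rightarrow> bool" where
  "matching M \<longleftrightarrow> (\<forall>e\<in>M. \<forall>e'\<in>M. e \<noteq> e' \<longrightarrow> e \<inter> e' = {})"

text \<open>The matching covers exactly \<open>X\<close>: for two-element edges this is a perfect
  matching of the subgraph induced on \<open>X\<close>. Keeping \<open>E\<close> fixed lets
  \<open>X\<close> shrink in inductions.\<close>

definition perfectly_matched :: "'a set set \<Rightarrow> 'a set \<Rightarrow> bool" where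
  "perfectly_matched E X \<longleftrightarrow> (\<exists>M\<subseteq>E. matching M \<and> \<Union>M = X)"

lemma perfectly_matched_empty: "perfectly_matched E {}"
  unfolding perfectly_matched_def by (rule exI[of _ "{}"]) (simp add: matching_def)

lemma perfectly_matched_edge: "e \<in> E \<Longrightarrow> perfectly_matched E e"
  unfolding perfectly_matched_def by (rule exI[of _ "{e}"]) (simp add: matching_def)

lemma perfectly_matched_Un:
  assumes "perfectly_matched E X" "perfectly_matched E Y" "X \<inter> Y = {}"
  shows "perfectly_matched E (X \<union> Y)"
proof -
  obtain M N where MN: "M \<subseteq> E" "matching M" "\<Union>M = X" "N \<subseteq> E" "matching N" "\<Union>N = Y"
    using assms unfolding perfectly_matched_def by blast
  have "e \<inter> e' = {}" if "e \<in> M" "e' \<in> N" for e e' using that MN assms(3) by blast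
  then have "matching (M \<union> N)"
    using MN(2,5) unfolding matching_def by (metis Int_commute UnE)
  moreover have "M \<union> N \<subseteq> E" "\<Union>(M \<union> N) = X \<union> Y" using MN by auto
  ultimately show ?thesis unfolding perfectly_matched_def by blast
qed

lemma perfectly_matched_insert_edge:
  "\<lbrakk>{x, y} \<in> E; perfectly_matched E X; x \<notin> X; y \<notin> X\<rbrakk> \<Longrightarrow> perfectly_matched E ({x, y} \<union> X)"
  by (rule perfectly_matched_Un[OF perfectly_matched_edge]) auto

lemma even_card_obtain_two:
  assumes "finite A" "even (card A)" "A \<noteq> {}"
  obtains x y where "x \<in> A" "y \<in> A" "x \<noteq> y"
proof -
  obtain x where x: "x \<in> A" using assms(3) by blast
  have "A \<noteq> {x}" using assms(2) by auto
  then show ?thesis using x that by blast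
qed

lemma card_Diff_two:
  assumes "finite A" "x \<in> A" "y \<in> A" "x \<noteq> y"
  shows "card A = card (A - {x, y}) + 2"
proof -
  have "A = insert x (insert y (A - {x, y}))" using assms by auto
  then have "card A = card (insert x (insert y (A - {x, y})))" by simp
  also have "\<dots> = card (A - {x, y}) + 2" using assms by (simp del: insert_Diff_single)
  finally show ?thesis .
qed

lemma clique_perfectly_matched:
  assumes "finite A" "even (card A)" "\<forall>x\<in>A. \<forall>y\<in>A. x \<noteq> y \<longrightarrow> {x, y} \<in> E"
  shows "perfectly_matched E A"
  using assms
proof (induction A rule: finite_psubset_induct)
  case (psubset A)
  show ?case
  proof (cases "A = {}")
    case True
    then show ?thesis by (simp add: perfectly_matched_empty)
  next
    case False
    then obtain x y where xy: "x \<in> A" "y \<in> A" "x \<noteq> y"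
      using even_card_obtain_two[OF psubset.hyps psubset.prems(1)] by blast
    have "perfectly_matched E (A - {x, y})"
    proof (rule psubset.IH)
      show "A - {x, y} \<subset> A" using xy by blast
      show "even (card (A - {x, y}))" using card_Diff_two[OF psubset.hyps xy] psubset.prems(1) by simp
    qed (use psubset.prems(2) in blast)
    then have "perfectly_matched E ({x, y} \<union> (A - {x, y}))"
      using psubset.prems(2) xy by (intro perfectly_matched_insert_edge) auto
    moreover have "{x, y} \<union> (A - {x, y}) = A" using xy by auto
    ultimately show ?thesis by simp
  qed
qed

text \<open>Induct by removing an edge \<open>pq\<close>. Suppose the rest splits into odd sides
  \<open>A\<close>, \<open>B\<close> with no edge between them. As no triple is independent, both
  sides are cliques, and each of \<open>p\<close>, \<open>q\<close> is joined to all of one side.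
  Either they can be matched into different sides, leaving even cliques, or both attach to the same
  side and enlarge the split.\<close>

lemma perfectly_matched_or_co_bipartite:
  assumes "finite X" "even (card X)"
    and "\<And>x y z. \<lbrakk>x \<in> X; y \<in> X; z \<in> X; x \<noteq> y; y \<noteq> z; x \<noteq> z\<rbrakk> \<Longrightarrow> {x, y} \<in> E \<or> {y, z} \<in> E \<or> {x, z} \<in> E"
  shows "perfectly_matched E X \<or>
    (\<exists>A B. A \<union> B = X \<and> A \<inter> B = {} \<and> odd (card A) \<and> odd (card B) \<and> (\<forall>a\<in>A. \<forall>b\<in>B. {a, b} \<notin> E))"
  using assms
proof (induction X rule: finite_psubset_induct)
  case (psubset X)
  note fin = psubset.hyps and tri = psubset.prems(2)
  have bipI: ?case
    if "A \<union> B = X" "A \<inter> B = {}" "odd (card A)" "odd (card B)"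
      "\<And>a b. a \<in> A \<Longrightarrow> b \<in> B \<Longrightarrow> {a, b} \<notin> E" for A B
    using that by blast
  show ?case
  proof (cases "\<exists>p\<in>X. \<exists>q\<in>X. p \<noteq> q \<and> {p, q} \<in> E")
    case False
    then have none': "{p, q} \<notin> E" if "p \<in> X" "q \<in> X" "p \<noteq> q" for p q using that by metis
    show ?thesis
    proof (cases "X = {}")
      case True
      then show ?thesis by (simp add: perfectly_matched_empty)
    next
      case False
      then obtain p q where pq: "p \<in> X" "q \<in> X" "p \<noteq> q"
        using even_card_obtain_two[OF fin psubset.prems(1)] by blast
      \<comment> \<open>A third vertex would give an independent triple.\<close>
      have "X \<subseteq> {p, q}"
      proof
        fix r assume "r \<in> X"
        show "r \<in> {p, q}"
        proof (rule ccontr)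
          assume "r \<notin> {p, q}"
          then have "p \<noteq> r" "q \<noteq> r" by auto
          then show False using tri[OF pq(1,2) \<open>r \<in> X\<close> pq(3)] none' pq \<open>r \<in> X\<close> by metis
        qed
      qed
      then have "X = {p, q}" using pq by blast
      then show ?thesis
        by (intro bipI[of "{p}" "{q}"]) (use pq none'[of p q] in auto)
    qed
  next
    case True
    then obtain p q where pq: "p \<in> X" "q \<in> X" "p \<noteq> q" "{p, q} \<in> E" by blast
    have cardX: "card X = card (X - {p, q}) + 2" using card_Diff_two[OF fin pq(1-3)] .
    have "perfectly_matched E (X - {p, q}) \<or> (\<exists>A B. A \<union> B = X - {p, q} \<and> A \<inter> B = {} \<and>
        odd (card A) \<and> odd (card B) \<and> (\<forall>a\<in>A. \<forall>b\<in>B. {a, b} \<notin> E))"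
    proof (rule psubset.IH)
      show "X - {p, q} \<subset> X" "even (card (X - {p, q}))" using pq cardX psubset.prems(1) by auto
    qed (use tri in blast)
    then show ?thesis
    proof (elim disjE exE conjE)
      assume "perfectly_matched E (X - {p, q})"
      then have "perfectly_matched E ({p, q} \<union> (X - {p, q}))"
        using pq by (intro perfectly_matched_insert_edge) auto
      moreover have "{p, q} \<union> (X - {p, q}) = X" using pq by auto
      ultimately show ?thesis by simp
    next
      fix A B
      assume AB: "A \<union> B = X - {p, q}" "A \<inter> B = {}" "odd (card A)" "odd (card B)"
        and "\<forall>a\<in>A. \<forall>b\<in>B. {a, b} \<notin> E"
      then have non: "\<And>a b. a \<in> A \<Longrightarrow> b \<in> B \<Longrightarrow> {a, b} \<notin> E" by metis
      have finAB: "finite A" "finite B" using AB(1) fin finite_subset[of A X] finite_subset[of B X] by blast+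
      have ne: "A \<noteq> {}" "B \<noteq> {}" using AB(3,4) by auto
      have sub: "\<And>a. a \<in> A \<Longrightarrow> a \<in> X \<and> a \<noteq> p \<and> a \<noteq> q" "\<And>b. b \<in> B \<Longrightarrow> b \<in> X \<and> b \<noteq> p \<and> b \<noteq> q"
        using AB(1) by blast+
      have cliqueA: "{a, a'} \<in> E" if "a \<in> A" "a' \<in> A" "a \<noteq> a'" for a a'
      proof -
        obtain b where b: "b \<in> B" using ne by blast
        then have "a \<noteq> b" "a' \<noteq> b" using AB(2) that by blast+
        then show ?thesis using tri[of a a' b] that sub(1)[of a] sub(1)[of a'] sub(2)[of b] non b by simp
      qed
      have cliqueB: "{b, b'} \<in> E" if "b \<in> B" "b' \<in> B" "b \<noteq> b'" for b b'
      proof -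
        obtain a where a: "a \<in> A" using ne by blast
        then have "a \<noteq> b" "a \<noteq> b'" using AB(2) that by blast+
        then show ?thesis using tri[of b b' a] that sub(2)[of b] sub(2)[of b'] sub(1)[of a] non a
          by (simp add: insert_commute)
      qed
      have joined: "{r, a} \<in> E \<or> {r, b} \<in> E" if "r \<in> {p, q}" "a \<in> A" "b \<in> B" for r a b
        using tri[of a r b] that sub[of a] sub[of b] AB(2) non pq by (auto simp: insert_commute)
      \<comment> \<open>Each odd clique loses the one vertex matched to \<open>r\<close> or
        \<open>s\<close> and becomes an even clique.\<close>
      have split: "perfectly_matched E X"
        if h: "a \<in> A" "b \<in> B" "{r, a} \<in> E" "{s, b} \<in> E" "{r, s} = {p, q}" for a b r s
      proof -
        have rs: "r \<noteq> s" "r \<in> {p, q}" "s \<in> {p, q}" using h(5) pq(3) by (auto simp: doubleton_eq_iff)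
        have "perfectly_matched E (A - {a})" "perfectly_matched E (B - {b})"
          using AB h finAB cliqueA cliqueB by (auto intro!: clique_perfectly_matched)
        then have "perfectly_matched E ({r, a} \<union> ({s, b} \<union> ((A - {a}) \<union> (B - {b}))))"
          using h rs AB(2) sub[of r] sub[of s] sub(1)[of a] sub(2)[of b] sub(1)[of r] sub(1)[of s]
          by (intro perfectly_matched_insert_edge perfectly_matched_Un[of E "A - {a}"]) auto
        moreover have "{r, a} \<union> ({s, b} \<union> ((A - {a}) \<union> (B - {b}))) = {r, s} \<union> (A \<union> B)"
          using h by auto
        moreover have "{r, s} \<union> (A \<union> B) = X" using h(5) AB(1) pq by auto
        ultimately show ?thesis by simp
      qed
      show ?thesis
      proof (cases "\<exists>a\<in>A. \<exists>b\<in>B. {p, a} \<in> E \<and> {q, b} \<in> E \<or> {q, a} \<in> E \<and> {p, b} \<in> E")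
        case True
        then show ?thesis using split[of _ _ p q] split[of _ _ q p] by (auto simp: insert_commute)
      next
        case no: False
        have grow: "odd (card (insert p (insert q C)))" if "C \<subseteq> X - {p, q}" "odd (card C)" for C
        proof -
          have "finite C" using that(1) fin finite_subset by blast
          then show ?thesis using that pq by (subst card_insert_disjoint | auto)+
        qed
        have oddA: "odd (card (insert p (insert q A)))" and oddB: "odd (card (insert p (insert q B)))"
          using grow[of A] grow[of B] AB by blast+
        \<comment> \<open>By \<open>joined\<close>, \<open>p\<close> is adjacent to all of
          \<open>A\<close> or to all of \<open>B\<close>. Since \<open>p\<close> and
          \<open>q\<close> cannot be matched into opposite sides, \<open>q\<close> follows
          \<open>p\<close>, and neither has a neighbour on the other side.\<close>
        show ?thesis
        proof (cases "\<forall>a\<in>A. {p, a} \<in> E")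
          case True
          obtain a0 where a0: "a0 \<in> A" using ne by blast
          have qB: "{q, b} \<notin> E" if "b \<in> B" for b using no True a0 that by blast
          then have "{q, a} \<in> E" if "a \<in> A" for a using joined[of q a] that ne by blast
          then have pB: "{p, b} \<notin> E" if "b \<in> B" for b using no a0 that by blast
          show ?thesis
            by (rule bipI[of "insert p (insert q A)" B])
              (use pB qB non AB oddA sub pq in auto)
        next
          case False
          then obtain a1 where a1: "a1 \<in> A" "{p, a1} \<notin> E" by blast
          obtain b0 where b0: "b0 \<in> B" using ne by blast
          have "{p, b} \<in> E" if "b \<in> B" for b using joined[of p a1 b] a1 that by blast
          then have qA: "{q, a} \<notin> E" if "a \<in> A" for a using no b0 that by blast
          then have "{q, b} \<in> E" if "b \<in> B" for b using joined[of q _ b] that ne by blast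
          then have pA: "{p, a} \<notin> E" if "a \<in> A" for a using no b0 that by blast
          show ?thesis
            by (rule bipI[of A "insert p (insert q B)"])
              (use pA qA non AB oddB sub pq in \<open>auto simp: insert_commute\<close>)
        qed
      qed
    qed
  qed
qed

subsection \<open>Edge-cuts of dense regular graphs\<close>

lemma simple_graph_finite: "simple_graph V E \<Longrightarrow> finite E"
  unfolding simple_graph_def by (meson finite_Pow_iff finite_subset PowI subsetI)

definition crossing :: "'a set set \<Rightarrow> 'a set \<Rightarrow> 'a set set" where
  "crossing E S = {e \<in> E. e \<inter> S \<noteq> {} \<and> \<not> e \<subseteq> S}"

text \<open>Double counting of incidences: an edge inside \<open>S\<close> counts twice, a crossing
  edge once.\<close>

lemma sum_degree:
  assumes "finite E" "\<forall>e\<in>E. card e = 2" "finite S"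
  shows "(\<Sum>v\<in>S. degree E v) = 2 * card {e \<in> E. e \<subseteq> S} + card (crossing E S)"
proof -
  have "(\<Sum>v\<in>S. degree E v) = (\<Sum>v\<in>S. \<Sum>e\<in>E. if v \<in> e then 1 else 0)"
    using assms(1) by (simp add: degree_def sum.If_cases Int_def)
  also have "\<dots> = (\<Sum>e\<in>E. \<Sum>v\<in>S. if v \<in> e then 1 else 0)" by (rule sum.swap)
  also have "\<dots> = (\<Sum>e\<in>E. card (e \<inter> S))"
    using assms(3) by (simp add: sum.If_cases Int_def conj_commute)
  also have "\<dots> = (\<Sum>e\<in>E. (if e \<subseteq> S then 2 else 0) + (if e \<in> crossing E S then 1 else 0))"
  proof (rule sum.cong)
    fix e assume e: "e \<in> E"
    then obtain x y where "e = {x, y}" "x \<noteq> y" using assms(2) by (meson card_2_iff)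
    then show "card (e \<inter> S) = (if e \<subseteq> S then 2 else 0) + (if e \<in> crossing E S then 1 else 0)"
      using e by (auto simp: crossing_def Int_insert_left)
  qed simp
  also have "\<dots> = 2 * card {e \<in> E. e \<subseteq> S} + card (crossing E S)"
    using assms(1) by (simp add: sum.distrib sum.If_cases Int_def crossing_def)
  finally show ?thesis .
qed

lemma component_closed:
  assumes "\<And>x y. \<lbrakk>{x, y} \<in> E; x \<in> S\<rbrakk> \<Longrightarrow> y \<in> S" "v \<in> S"
  shows "component V E v \<subseteq> S"
proof
  fix w assume "w \<in> component V E v"
  then have "(v, w) \<in> {(x, y). {x, y} \<in> E}\<^sup>*" by (simp add: component_def)
  then show "w \<in> S" using assms by (induction rule: rtrancl_induct) auto
qed

lemma component_self: "v \<in> V \<Longrightarrow> v \<in> component V E v"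
  by (simp add: component_def)

lemma component_step:
  "\<lbrakk>x \<in> component V E v; {x, y} \<in> E; y \<in> V\<rbrakk> \<Longrightarrow> y \<in> component V E v"
  by (auto simp: component_def intro: rtrancl.rtrancl_into_rtrancl)

lemma component_eq:
  assumes "w \<in> component V E v"
  shows "component V E w = component V E v"
proof -
  let ?R = "{(x, y). {x, y} \<in> E}"
  have "sym ?R" by (auto simp: sym_def insert_commute)
  then have "sym (?R\<^sup>*)" by (rule sym_rtrancl)
  moreover have "(v, w) \<in> ?R\<^sup>*" using assms by (simp add: component_def)
  ultimately have "(w, v) \<in> ?R\<^sup>*" "(v, w) \<in> ?R\<^sup>*" by (auto dest: symD)
  then show ?thesis unfolding component_def by (auto intro: rtrancl_trans)
qed

lemma crossing_nonempty:
  assumes "simple_graph V E" "connected_graph V E" "S \<subseteq> V" "S \<noteq> {}" "S \<noteq> V"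
  shows "crossing E S \<noteq> {}"
proof
  assume *: "crossing E S = {}"
  obtain v where v: "v \<in> S" using assms(4) by blast
  have "component V E v \<subseteq> S"
    using * v by (intro component_closed) (auto simp: crossing_def)
  then show False using assms v unfolding connected_graph_def by blast
qed

lemma crossing_Compl:
  assumes "simple_graph V E" "S \<subseteq> V"
  shows "crossing E (V - S) = crossing E S"
  using assms unfolding crossing_def simple_graph_def by blast

text \<open>It suffices to treat a side with \<open>t \<le> card V / 2\<close> vertices. If
  \<open>t \<le> d\<close>, at most \<open>t (t - 1)\<close> of the \<open>t d\<close> edge ends
  belong to inner edges, and \<open>t (d - t + 1) \<ge> d\<close>. If \<open>t > d\<close>, the
  bound on \<open>card V\<close> gives \<open>d \<le> 2\<close>; connectedness yields one crossing
  edge, and for \<open>d = 2\<close> parity yields a second.\<close>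

lemma regular_crossing_lower_bound:
  assumes G: "simple_graph V E" "connected_graph V E" and reg: "regular d V E"
    and n: "card V \<le> d + 4" and S: "S \<subseteq> V" "S \<noteq> {}" "S \<noteq> V"
  shows "d \<le> card (crossing E S)"
proof -
  have finV: "finite V" and card2: "\<forall>e\<in>E. card e = 2" using G(1) by (auto simp: simple_graph_def)
  have finE: "finite E" using simple_graph_finite[OF G(1)] .
  have half: "d \<le> card (crossing E T)"
    if T: "T \<subseteq> V" "T \<noteq> {}" "T \<noteq> V" "2 * card T \<le> card V" for T
  proof -
    have finT: "finite T" using T(1) finV finite_subset by blast
    have "(\<Sum>v\<in>T. degree E v) = card T * d"
      using reg T(1) by (simp add: regular_def subset_iff)
    then have eq: "card T * d = 2 * card {e \<in> E. e \<subseteq> T} + card (crossing E T)"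
      using sum_degree[OF finE card2 finT] by simp
    have finc: "finite (crossing E T)" using finE by (simp add: crossing_def)
    then have pos: "0 < card (crossing E T)"
      using crossing_nonempty[OF G T(1-3)] by (simp add: card_gt_0_iff)
    show ?thesis
    proof (cases "card T \<le> d")
      case True
      have "card {e \<in> E. e \<subseteq> T} \<le> card {e. e \<subseteq> T \<and> card e = 2}"
        using card2 finT by (intro card_mono) auto
      also have "\<dots> = card T choose 2" by (rule n_subsets[OF finT])
      finally have le: "2 * card {e \<in> E. e \<subseteq> T} \<le> card T * (card T - 1)"
        by (simp add: choose_two)
      obtain t where t: "card T = Suc t" using T(2) finT by (metis card_0_eq not0_implies_Suc)
      obtain r where r: "d = Suc t + r" using True t by (metis le_iff_add)
      \<comment> \<open>In these variables the lower bound for the crossing edges exceeds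
        \<open>d\<close> by \<open>t * r\<close>.\<close>
      show ?thesis using eq le unfolding t r by (simp add: algebra_simps)
    next
      case False
      then have "d \<le> 2" using T(4) n by linarith
      moreover have "even (card (crossing E T))" if "d = 2"
      proof -
        have "even (card T * d)" using that by simp
        then show ?thesis unfolding eq by simp
      qed
      ultimately show ?thesis using pos by (cases "d = 2") (auto elim!: evenE)
    qed
  qed
  show ?thesis
  proof (cases "2 * card S \<le> card V")
    case True
    then show ?thesis using half S by blast
  next
    case False
    then have "2 * card (V - S) \<le> card V"
      using S(1) finV by (simp add: card_Diff_subset finite_subset)
    then have "d \<le> card (crossing E (V - S))" using S by (intro half) auto
    then show ?thesis using crossing_Compl[OF G(1) S(1)] by simp
  qed
qed

text \<open>A rainbow cut separating \<open>u\<close> from \<open>v\<close> contains every edge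
  leaving the component of \<open>u\<close>; there are at least \<open>d\<close> of these, all of
  different colours.\<close>

lemma rainbow_disconnected_lower_bound:
  assumes G: "simple_graph V E" "connected_graph V E" and reg: "regular d V E"
    and n: "card V \<le> d + 4" "2 \<le> card V"
    and c: "c ` E \<subseteq> {1..m}" "rainbow_disconnected V E c"
  shows "d \<le> m"
proof -
  have "V \<noteq> {}" using n(2) by auto
  then obtain u where u: "u \<in> V" by blast
  have "V \<noteq> {u}" using n(2) by auto
  then obtain v where uv: "u \<in> V" "v \<in> V" "u \<noteq> v" using u by blast
  then obtain R where "rainbow_cut_between V E c u v R"
    using c(2) unfolding rainbow_disconnected_def by blast
  then have R: "R \<subseteq> E" "inj_on c R" "component V (E - R) u \<noteq> component V (E - R) v"
    by (simp_all add: rainbow_cut_between_def rainbow_cut_def edge_cut_def)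
  let ?S = "component V (E - R) u"
  have S: "u \<in> ?S" "v \<notin> ?S" "?S \<subseteq> V"
    using component_self[OF uv(1)] component_eq[of v V "E - R" u] R(3) by (auto simp: component_def)
  have "crossing E ?S \<subseteq> R"
  proof
    fix e assume e: "e \<in> crossing E ?S"
    then have "e \<in> E" "e \<inter> ?S \<noteq> {}" "\<not> e \<subseteq> ?S" unfolding crossing_def by blast+
    then obtain x y where xy: "e \<in> E" "x \<in> e" "y \<in> e" "x \<in> ?S" "y \<notin> ?S" by blast
    then have "card e = 2" "y \<in> V" "x \<noteq> y" using G(1) by (auto simp: simple_graph_def)
    then have "e = {x, y}" using xy(2,3) by (auto simp: card_2_iff)
    then show "e \<in> R" using xy component_step[of x V "E - R" u y] \<open>y \<in> V\<close> by blast
  qed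
  have finE: "finite E" using simple_graph_finite[OF G(1)] .
  have "d \<le> card (crossing E ?S)"
    using S uv by (intro regular_crossing_lower_bound[OF G reg n(1)]) auto
  also have "\<dots> \<le> card R"
    using \<open>crossing E ?S \<subseteq> R\<close> R(1) finE by (meson card_mono finite_subset)
  also have "\<dots> = card (c ` R)" by (simp add: card_image[OF R(2)])
  also have "\<dots> \<le> card {1..m}" using c(1) R(1) by (intro card_mono) auto
  finally show ?thesis by simp
qed

subsection \<open>Deleting a vertex\<close>

lemma edge_eqI: "\<lbrakk>card e = 2; x \<in> e; y \<in> e; x \<noteq> y\<rbrakk> \<Longrightarrow> e = {x, y}"
  by (auto simp: card_2_iff)

text \<open>A neighbour \<open>v\<close> of \<open>w\<close> has lost the edge \<open>wv\<close>,
  hence misses one of the \<open>d\<close> colours in \<open>G - w\<close>. Colours may repeat at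
  \<open>w\<close>, but of two distinct vertices one is not \<open>w\<close>, and its star serves as
  the cut.\<close>

lemma rainbow_disconnected_of_delete_vertex:
  assumes G: "simple_graph V E" and deg: "\<And>v. v \<in> V \<Longrightarrow> degree E v \<le> d"
    and col: "edge_colorable {e \<in> E. w \<notin> e} d"
  shows "\<exists>c. c ` E \<subseteq> {1..d} \<and> rainbow_disconnected V E c"
proof -
  have finE: "finite E" and sub: "\<And>e. e \<in> E \<Longrightarrow> e \<subseteq> V" and card2: "\<And>e. e \<in> E \<Longrightarrow> card e = 2"
    using simple_graph_finite[OF G] G by (auto simp: simple_graph_def)
  let ?J = "{e \<in> E. w \<notin> e}"
  obtain f where f: "f ` ?J \<subseteq> {1..d}" "proper ?J f" using col by (auto simp: edge_colorable_def)
  define g where "g v = (SOME \<alpha>. \<alpha> \<in> missing d ?J f v)" for v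
  have g: "g v \<in> missing d ?J f v" if "{w, v} \<in> E" for v
  proof -
    have "degree ?J v \<le> degree (E - {{w, v}}) v" using finE by (intro degree_mono) auto
    moreover have "degree E v = Suc (degree (E - {{w, v}}) v)"
      using degree_remove[OF finE that, of v] by simp
    ultimately have "degree ?J v < d" using deg[of v] sub[OF that] by simp
    then have "missing d ?J f v \<noteq> {}" using finE by (intro missing_nonempty) auto
    then show ?thesis unfolding g_def by (simp add: some_in_eq)
  qed
  \<comment> \<open>\<open>the_elem (e - {w})\<close> is the other end of an edge at
    \<open>w\<close>.\<close>
  define c where "c e = (if w \<in> e then g (the_elem (e - {w})) else f e)" for e
  have cw: "c {w, v} = g v" if "v \<noteq> w" for v
  proof -
    have "{w, v} - {w} = {v}" using that by auto
    then show ?thesis by (simp add: c_def)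
  qed
  have cn: "c e = f e" if "w \<notin> e" for e using that by (simp add: c_def)
  have "c e \<in> {1..d}" if "e \<in> E" for e
  proof (cases "w \<in> e")
    case True
    then obtain v where v: "e = {w, v}" "w \<noteq> v" using edge_other_end[OF card2[OF \<open>e \<in> E\<close>], of w] by metis
    then show ?thesis using g[of v] cw[of v] that by (simp add: missing_def)
  next
    case False
    then show ?thesis using that f(1) cn[OF False] by auto
  qed
  then have range: "c ` E \<subseteq> {1..d}" by blast
  \<comment> \<open>The second vertex \<open>u\<close> witnesses that isolating \<open>v\<close>
    disconnects the graph, as \<open>edge_cut\<close> demands.\<close>
  have star: "rainbow_cut V E c {e \<in> E. v \<in> e} \<and>
      component V (E - {e \<in> E. v \<in> e}) v = {v}"
    if v: "v \<in> V" "v \<noteq> w" "u \<in> V" "u \<noteq> v" for u v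
  proof -
    let ?R = "{e \<in> E. v \<in> e}"
    have comp: "component V (E - ?R) v = {v}"
      using component_closed[of "E - ?R" "{v}" v V] component_self[OF v(1), of "E - ?R"] by auto
    have mixed: "c e \<noteq> c e'" if "e \<in> ?R" "e' \<in> ?R" "w \<in> e" "w \<notin> e'" for e e'
    proof -
      have "e = {w, v}" using that edge_eqI[of e w v] card2[of e] v(2) by simp
      then have "c e \<in> missing d ?J f v" using g[of v] cw[of v] that v by simp
      then show ?thesis using missingD[of "c e" d ?J f v e'] that cn[of e'] by auto
    qed
    have "inj_on c ?R"
    proof (rule inj_onI)
      fix e e' assume e: "e \<in> ?R" "e' \<in> ?R" "c e = c e'"
      show "e = e'"
      proof (cases "w \<in> e")
        case True
        then have "w \<in> e'" using mixed[of e e'] e by blast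
        then have "e = {w, v}" "e' = {w, v}"
          using True e edge_eqI[of e w v] edge_eqI[of e' w v] card2[of e] card2[of e'] v(2) by simp_all
        then show ?thesis by simp
      next
        case False
        then have "w \<notin> e'" using mixed[of e' e] e by metis
        then show ?thesis using False e properD[OF f(2), of e e' v] cn by simp
      qed
    qed
    moreover have "edge_cut V E ?R"
      using comp v unfolding edge_cut_def connected_graph_def by auto
    ultimately show ?thesis using comp by (simp add: rainbow_cut_def)
  qed
  have "rainbow_disconnected V E c"
    unfolding rainbow_disconnected_def
  proof (intro ballI impI)
    fix u v assume uv: "u \<in> V" "v \<in> V" "u \<noteq> v"
    show "\<exists>R. rainbow_cut_between V E c u v R"
    proof (cases "v = w")
      case False
      then show ?thesis
        using star[of v u] uv component_self[of u V "E - {e \<in> E. v \<in> e}"]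
        unfolding rainbow_cut_between_def by (intro exI[of _ "{e \<in> E. v \<in> e}"]) auto
    next
      case True
      then show ?thesis
        using star[of u v] uv component_self[of v V "E - {e \<in> E. u \<in> e}"]
        unfolding rainbow_cut_between_def by (intro exI[of _ "{e \<in> E. u \<in> e}"]) auto
    qed
  qed
  then show ?thesis using range by blast
qed

section \<open>Colouring the graph left after deleting a vertex\<close>

lemma edge_colorable_add_matching:
  assumes "edge_colorable (E - M) D" "matching M"
  shows "edge_colorable E (Suc D)"
proof -
  obtain f where f: "f ` (E - M) \<subseteq> {1..D}" "proper (E - M) f"
    using assms(1) by (auto simp: edge_colorable_def)
  let ?g = "\<lambda>e. if e \<in> M then Suc D else f e"
  have fD: "f e \<noteq> Suc D" if "e \<in> E - M" for e using f(1) that by fastforce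
  have "proper E ?g"
  proof (rule properI)
    fix v e e' assume *: "e \<in> E" "e' \<in> E" "v \<in> e" "v \<in> e'" "?g e = ?g e'"
    show "e = e'"
    proof (cases "e \<in> M")
      case True
      then have "e' \<in> M" using * fD[of e'] by (metis DiffI)
      then show ?thesis using True * assms(2) unfolding matching_def by blast
    next
      case False
      then have "e' \<notin> M" using * fD[of e] by (metis DiffI)
      then show ?thesis using False * properD[OF f(2), of e e' v] by simp
    qed
  qed
  moreover have "?g ` E \<subseteq> {1..Suc D}" using f(1) by fastforce
  ultimately show ?thesis unfolding edge_colorable_def by blast
qed

text \<open>The neighbourhood of \<open>v\<close> in the complement graph \<open>H\<close>.\<close>

definition non_neighbours :: "'a set \<Rightarrow> 'a set set \<Rightarrow> 'a \<Rightarrow> 'a set" where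
  "non_neighbours V E v = {u \<in> V. u \<noteq> v \<and> {v, u} \<notin> E}"

lemma non_neighbours_sym: "\<lbrakk>u \<in> non_neighbours V E v; v \<in> V\<rbrakk> \<Longrightarrow> v \<in> non_neighbours V E u"
  by (auto simp: non_neighbours_def insert_commute)

lemma card_non_neighbours:
  assumes "simple_graph V E" "v \<in> V"
  shows "card V = Suc (degree E v + card (non_neighbours V E v))"
proof -
  let ?N = "{u. {v, u} \<in> E}"
  have finV: "finite V" and card2: "\<And>e. e \<in> E \<Longrightarrow> card e = 2" and sub: "\<And>e. e \<in> E \<Longrightarrow> e \<subseteq> V"
    using assms(1) by (auto simp: simple_graph_def)
  have N: "?N \<subseteq> V - {v}" using card2 sub by fastforce
  have "{e \<in> E. v \<in> e} \<subseteq> (\<lambda>u. {v, u}) ` ?N"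
  proof
    fix e assume e: "e \<in> {e \<in> E. v \<in> e}"
    then obtain u where "e = {v, u}" using edge_other_end[OF card2, of e v] by auto
    then show "e \<in> (\<lambda>u. {v, u}) ` ?N" using e by blast
  qed
  then have "{e \<in> E. v \<in> e} = (\<lambda>u. {v, u}) ` ?N" by blast
  moreover have "inj_on (\<lambda>u. {v, u}) ?N" by (auto simp: inj_on_def doubleton_eq_iff)
  ultimately have deg: "degree E v = card ?N" by (simp add: degree_def card_image)
  have "V = insert v (?N \<union> non_neighbours V E v)"
    using N assms(2) by (auto simp: non_neighbours_def)
  moreover have "card (insert v (?N \<union> non_neighbours V E v)) = Suc (card ?N + card (non_neighbours V E v))"
  proof -
    have "finite ?N" "finite (non_neighbours V E v)"
      using N finV by (auto simp: non_neighbours_def intro: finite_subset)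
    moreover have "v \<notin> ?N" using N by blast
    then have "?N \<inter> non_neighbours V E v = {}" "v \<notin> ?N \<union> non_neighbours V E v"
      by (auto simp: non_neighbours_def)
    ultimately show ?thesis by (simp add: card_Un_disjoint)
  qed
  ultimately show ?thesis using deg by simp
qed

lemma degree_delete_vertex:
  assumes "finite E" "v \<noteq> w" "{w, v} \<in> E"
  shows "degree {e \<in> E. w \<notin> e} v < degree E v"
proof -
  have "degree {e \<in> E. w \<notin> e} v \<le> degree (E - {{w, v}}) v" using assms by (intro degree_mono) auto
  then show ?thesis using degree_remove[OF assms(1,3), of v] by simp
qed

lemma degree_outside: "\<lbrakk>simple_graph V E; v \<notin> V\<rbrakk> \<Longrightarrow> degree E v = 0"
  by (auto simp: degree_def simple_graph_def intro!: card_eq_0_iff[THEN iffD2])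

lemma degree_deleted_vertex: "degree {e \<in> E. w \<notin> e} w = 0"
  by (simp add: degree_def)

text \<open>Neighbours of \<open>w\<close> lose an edge, so only its non-neighbours can keep degree
  \<open>d\<close>. As \<open>0 < d\<close>, neither \<open>w\<close> nor a vertex outside
  \<open>V\<close>, both of degree 0, counts as saturated.\<close>

lemma edge_colorable_delete_vertex_path_core:
  assumes G: "simple_graph V E" and reg: "regular d V E" and "w \<in> V" "0 < d"
    and abc: "non_neighbours V E w \<subseteq> {a, b, c}" "{a, b} \<notin> E"
  shows "edge_colorable {e \<in> E. w \<notin> e} d"
proof (rule edge_colorable_path_core[of _ _ a b c])
  have finE: "finite E" using simple_graph_finite[OF G] .
  let ?J = "{e \<in> E. w \<notin> e}"
  have le: "degree ?J v \<le> degree E v" for v using finE by (intro degree_mono) auto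
  have Ed: "degree E v = d" if "v \<in> V" for v using reg that by (simp add: regular_def)
  show "finite ?J" using finE by simp
  show "\<forall>e\<in>?J. card e = 2" using G by (simp add: simple_graph_def)
  show "degree ?J v \<le> d" for v
    using le[of v] Ed[of v] degree_outside[OF G, of v] by (cases "v \<in> V") auto
  show "v \<in> {a, b, c}" if "degree ?J v = d" for v
  proof -
    have "v \<noteq> w" using that degree_deleted_vertex[of E w] \<open>0 < d\<close> by auto
    moreover have "v \<in> V" using that le[of v] degree_outside[OF G, of v] \<open>0 < d\<close> by auto
    ultimately have "{w, v} \<notin> E" using degree_delete_vertex[OF finE, of v w] Ed[of v] that by auto
    then show ?thesis using abc(1) \<open>v \<noteq> w\<close> \<open>v \<in> V\<close> by (auto simp: non_neighbours_def)
  qed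
  show "{a, b} \<notin> ?J" using abc(2) by simp
qed

text \<open>Removing a perfect matching of \<open>G\<close> through \<open>wz\<close> and \<open>ab\<close> from \<open>G - w\<close> leaves \<open>a, b, c, z\<close> as the only
  possible saturated vertices, and among these \<open>a\<close> is adjacent at most to \<open>c\<close>.\<close>

lemma edge_colorable_delete_vertex_matching:
  assumes G: "simple_graph V E" and reg: "regular d V E" and "w \<in> V" "2 \<le> d"
    and abc: "non_neighbours V E w = {a, b, c}" "a \<noteq> b" "a \<noteq> c" "b \<noteq> c"
    and E: "{a, b} \<in> E" "{a, c} \<in> E" "{w, z} \<in> E" "{a, z} \<notin> E"
    and pm: "perfectly_matched E (V - {w, z, a, b})"
  shows "edge_colorable {e \<in> E. w \<notin> e} d"
proof -
  have finE: "finite E" and sub: "\<And>e. e \<in> E \<Longrightarrow> e \<subseteq> V" and card2: "\<And>e. e \<in> E \<Longrightarrow> card e = 2"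
    using simple_graph_finite[OF G] G by (auto simp: simple_graph_def)
  have ne: "x \<noteq> y" if "{x, y} \<in> E" for x y using card2[OF that] by auto
  have w: "{w, a} \<notin> E" "{w, b} \<notin> E" "{w, c} \<notin> E" "a \<noteq> w" "b \<noteq> w" "c \<noteq> w"
    using abc(1) unfolding non_neighbours_def by blast+
  have z: "z \<noteq> a" "z \<noteq> b" "z \<noteq> c" "z \<noteq> w" using w E(3) ne[OF E(3)] by auto
  obtain M where M: "M \<subseteq> E" "matching M" "\<Union>M = V - {w, z, a, b}"
    using pm unfolding perfectly_matched_def by blast
  \<comment> \<open>A perfect matching of \<open>G\<close>, which becomes the last colour
    class.\<close>
  let ?F = "insert {w, z} (insert {a, b} M)"
  have disj: "e \<inter> {w, z} = {}" "e \<inter> {a, b} = {}" if "e \<in> M" for e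
    using M(3) that w z by blast+
  have "{w, z} \<inter> {a, b} = {}" using w z by blast
  then have F: "matching ?F"
    using M(2) disj unfolding matching_def by (auto simp: Int_commute)
  have cover: "V \<subseteq> \<Union>?F" using M(3) by auto
  have FE: "?F \<subseteq> E" using M(1) E by simp
  let ?J = "{e \<in> E. w \<notin> e}"
  let ?J1 = "?J - ?F"
  \<comment> \<open>The edge \<open>{a, c}\<close> is set aside so that \<open>a\<close> and
    \<open>c\<close> fall below degree \<open>d - 1\<close>; a fan at \<open>a\<close> puts it
    back.\<close>
  let ?E1 = "?J1 - {{a, c}}"
  have Fdisj: "e = e'" if "e \<in> ?F" "e' \<in> ?F" "v \<in> e" "v \<in> e'" for e e' v
    using F[unfolded matching_def, rule_format, OF that(1,2)] that(3,4) by (metis disjoint_iff)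
  have "{a, c} \<notin> ?F" using Fdisj[of "{a, b}" "{a, c}" a] abc(2-4) by (auto simp: doubleton_eq_iff)
  then have ac: "{a, c} \<in> ?J1" using E(2) w by auto
  have le1: "degree ?J1 v \<le> degree ?J v" for v using finE by (intro degree_mono) auto
  have leJ: "degree ?J v \<le> degree E v" for v using finE by (intro degree_mono) auto
  have leE1: "degree ?E1 v \<le> degree ?J1 v" for v using finE by (intro degree_mono) auto
  have Ed: "degree E v = d" if "v \<in> V" for v using reg that by (simp add: regular_def)
  have zV: "z \<in> V" using sub[OF E(3)] by simp
  \<comment> \<open>Every vertex loses its edge of \<open>?F\<close>, but for \<open>z\<close> this
    is \<open>wz\<close>, already gone with \<open>w\<close>. So degree \<open>d - 1\<close> is left
    only to \<open>z\<close> and the non-neighbours of \<open>w\<close>.\<close>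
  have bound: "degree ?J1 v \<le> d - 1 \<and> (degree ?J1 v = d - 1 \<longrightarrow> v \<in> {a, b, c, z})" for v
  proof (cases "v \<in> V \<and> v \<noteq> w")
    case False
    then have "degree ?J1 v = 0"
      using le1[of v] leJ[of v] degree_outside[OF G, of v] degree_deleted_vertex[of E w] by auto
    then show ?thesis using \<open>2 \<le> d\<close> by simp
  next
    case True
    show ?thesis
    proof (cases "v = z")
      case True
      then show ?thesis
        using le1[of z] degree_delete_vertex[OF finE z(4) E(3)] Ed[OF zV] by simp
    next
      case False
      obtain e where e: "e \<in> ?F" "v \<in> e" using cover True by blast
      have "w \<notin> e" using Fdisj[of e "{w, z}" w] e True False by auto
      then have eJ: "e \<in> ?J" using e FE by auto
      have finJ: "finite ?J" using finE by simp
      have "degree ?J1 v \<le> degree (?J - {e}) v" using finE e by (intro degree_mono) auto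
      then have lt: "degree ?J1 v < degree ?J v" using degree_remove[OF finJ eJ e(2)] by simp
      have "degree ?J v < d" if "v \<notin> {a, b, c}"
      proof -
        have "{w, v} \<in> E" using that abc(1) True unfolding non_neighbours_def by blast
        then show ?thesis using degree_delete_vertex[OF finE, of v w] Ed[of v] True by auto
      qed
      then show ?thesis using lt leJ[of v] Ed[of v] True by fastforce
    qed
  qed
  have finJ1: "finite ?J1" using finE by simp
  have dac: "degree ?J1 a = Suc (degree ?E1 a)" "degree ?J1 c = Suc (degree ?E1 c)"
    using degree_remove[OF finJ1 ac] by simp_all
  have bound1: "degree ?E1 v \<le> d - 1 \<and> (degree ?E1 v = d - 1 \<longrightarrow> v \<in> {b, z})" for v
    using bound[of v] leE1[of v] dac by (cases "v = a \<or> v = c") auto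
  \<comment> \<open>Only \<open>b\<close> and \<open>z\<close> may be saturated here, so
    \<open>b, b\<close> serves as the non-adjacent pair.\<close>
  have "edge_colorable ?E1 (d - 1)"
  proof (rule edge_colorable_path_core[of _ _ b b z])
    show "{b, b} \<notin> ?E1" using ne[of b b] by blast
  qed (use finE card2 bound1 in auto)
  then have "edge_colorable ?J1 (d - 1)"
  proof (rule edge_colorable_insert[OF finJ1 _ ac, rotated 3])
    show "\<forall>e\<in>?J1. card e = 2" using card2 by simp
    show "degree ?J1 a \<le> d - 1" using bound by simp
    fix v assume "{a, v} \<in> ?J1"
    \<comment> \<open>\<open>ab\<close> lies in \<open>?F\<close> and \<open>az\<close> is no edge,
      so the fan at \<open>a\<close> meets no saturated vertex.\<close>
    then have "v \<noteq> b" "v \<noteq> z" using E(4) by auto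
    then show "degree ?E1 v < d - 1" using bound1[of v] by fastforce
  qed
  then have "edge_colorable ?J (Suc (d - 1))" using F by (rule edge_colorable_add_matching)
  then show ?thesis using \<open>2 \<le> d\<close> by simp
qed

text \<open>If the matching fails for \<open>z\<close>, the remaining vertices split co-bipartitely.
  The side away from \<open>c\<close> is a single vertex \<open>s\<close>, the other side is the
  whole complement neighbourhood of \<open>s\<close>, and \<open>c\<close> has complement neighbours
  \<open>w, z, s\<close>. Failure for both choices of \<open>z\<close> makes \<open>s\<close> the
  other choice, a complement neighbour of \<open>a\<close>, although \<open>a\<close> is not on the
  side of \<open>c\<close>.\<close>

lemma triangle_free_cubic_complement_matching:
  assumes G: "simple_graph V E" and card3: "\<And>v. v \<in> V \<Longrightarrow> card (non_neighbours V E v) = 3"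
    and tri: "\<And>v x y. \<lbrakk>v \<in> V; x \<in> non_neighbours V E v; y \<in> non_neighbours V E v; x \<noteq> y\<rbrakk> \<Longrightarrow> {x, y} \<in> E"
    and n: "even (card V)" "8 \<le> card V"
    and w: "w \<in> V" "non_neighbours V E w = {a, b, c}" "a \<noteq> b" "a \<noteq> c" "b \<noteq> c"
  shows "\<exists>z. z \<in> non_neighbours V E a \<and> z \<noteq> w \<and> perfectly_matched E (V - {w, z, a, b})"
proof (rule ccontr)
  let ?N = "non_neighbours V E"
  assume "\<not> ?thesis"
  then have unmatched: "\<not> perfectly_matched E (V - {w, z, a, b})" if "z \<in> ?N a" "z \<noteq> w" for z
    using that by blast
  have finV: "finite V" using G by (simp add: simple_graph_def)
  have NI: "u \<in> ?N v" if "u \<in> V" "u \<noteq> v" "{v, u} \<notin> E" for u v using that by (simp add: non_neighbours_def)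
  have ND: "u \<in> V" "u \<noteq> v" "{v, u} \<notin> E" if "u \<in> ?N v" for u v using that by (simp_all add: non_neighbours_def)
  have finN: "finite (?N v)" for v using finV by (simp add: non_neighbours_def)
  have abc: "a \<in> ?N w" "b \<in> ?N w" "c \<in> ?N w" using w(2) by simp_all
  have V: "a \<in> V" "b \<in> V" "c \<in> V" "a \<noteq> w" "b \<noteq> w" "c \<noteq> w" using ND[OF abc(1)] ND[OF abc(2)] ND[OF abc(3)] by simp_all
  have wN: "w \<in> ?N a" "w \<in> ?N c" using non_neighbours_sym[OF _ w(1)] abc by blast+
  have E: "{a, b} \<in> E" "{a, c} \<in> E" "{b, c} \<in> E" using tri[OF w(1)] abc w(3-5) by blast+
  have key: "\<exists>s. ?N c = {w, z, s} \<and> a \<notin> ?N s" if z: "z \<in> ?N a" "z \<noteq> w" for z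
  proof -
    let ?X = "V - {w, z, a, b}"
    have zV: "z \<in> V" "z \<noteq> a" "z \<noteq> b" "z \<noteq> c" using ND[OF z(1)] E by auto
    have "card {w, z, a, b} = 4" using z V zV w(3) by simp
    then have cardX: "card ?X = card V - 4"
      using card_Diff_subset[of "{w, z, a, b}" V] w(1) zV V by simp
    have cX: "c \<in> ?X" using V zV w(4,5) by auto
    \<comment> \<open>\<open>A\<close> is the side containing \<open>c\<close>; either side of the
      split can play this role.\<close>
    have sided: "\<exists>s. ?N c = {w, z, s} \<and> a \<notin> ?N s"
      if AB: "A \<union> B = ?X" "A \<inter> B = {}" "odd (card B)" "c \<in> A"
        and non: "\<And>x y. x \<in> A \<Longrightarrow> y \<in> B \<Longrightarrow> {x, y} \<notin> E" for A B
    proof -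
      have fin: "finite A" "finite B" using AB(1) finV by (metis finite_Diff finite_Un)+
      have inV: "x \<in> V" if "x \<in> A \<or> x \<in> B" for x using that AB(1) by blast
      have neq: "x \<noteq> y" if "x \<in> A" "y \<in> B" for x y using that AB(2) by blast
      have "x \<in> ?N c" if "x \<in> B" for x
        using NI[of x c] inV[of x] neq[OF AB(4) that] non[OF AB(4) that] that by simp
      \<comment> \<open>\<open>c\<close> has three non-neighbours, one of them \<open>w\<close>, so
        the odd side \<open>B\<close> is a single vertex.\<close>
      then have "insert w B \<subseteq> ?N c" using wN(2) by blast
      then have "card (insert w B) \<le> 3" using card_mono[OF finN] card3[OF V(3)] by metis
      moreover have "w \<notin> B" using AB(1) by blast
      ultimately have "card B \<le> 2" using fin by simp
      then have "card B = 1" using AB(3) by (cases "card B = 2") (auto simp: le_Suc_eq numeral_2_eq_2)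
      then obtain s where s: "B = {s}" by (rule card_1_singletonE)
      have "card ?X = card A + card B" using card_Un_disjoint[OF fin AB(2)] AB(1) by simp
      then have cA: "3 \<le> card A" using cardX n(2) \<open>card B = 1\<close> by linarith
      have "A \<subseteq> ?N s"
      proof
        fix x assume "x \<in> A"
        then show "x \<in> ?N s" using NI[of x s] inV neq[of x s] non[of x s] s by (auto simp: insert_commute)
      qed
      moreover have sV: "s \<in> V" using inV s by simp
      ultimately have As: "A = ?N s" using card_seteq[OF finN, of A s] cA card3[of s] by simp
      have "a \<notin> ?X" by simp
      then have "a \<notin> ?N s" using As AB(1) by blast
      have sc: "s \<in> ?N c" "s \<noteq> w" using \<open>insert w B \<subseteq> ?N c\<close> \<open>w \<notin> B\<close> s by auto
      have "card (?N c - {w, s}) = 1"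
        using card_Diff_subset[of "{w, s}" "?N c"] card3[OF V(3)] sc wN(2) by simp
      then obtain t where t: "?N c - {w, s} = {t}" by (rule card_1_singletonE)
      then have tN: "t \<in> ?N c" "t \<noteq> w" "t \<noteq> s" by blast+
      \<comment> \<open>Otherwise \<open>c\<close>, \<open>t\<close> and \<open>s\<close> would form
        a triangle in the complement.\<close>
      have "t \<notin> A"
      proof
        assume "t \<in> A"
        then have "{c, t} \<in> E" using tri[OF sV, of c t] As AB(4) ND(2)[OF tN(1)] by metis
        then show False using ND(3)[OF tN(1)] by simp
      qed
      then have "t \<notin> ?X" using AB(1) s tN(3) by blast
      then have "t \<in> {w, z, a, b}" using ND(1)[OF tN(1)] by blast
      then have "t = z" using tN(2) ND(3)[OF tN(1)] E by (auto simp: insert_commute)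
      then have "?N c = {w, z, s}" using t wN(2) sc by blast
      then show ?thesis using \<open>a \<notin> ?N s\<close> by blast
    qed
    have "perfectly_matched E ?X \<or> (\<exists>A B. A \<union> B = ?X \<and> A \<inter> B = {} \<and> odd (card A) \<and> odd (card B) \<and>
      (\<forall>x\<in>A. \<forall>y\<in>B. {x, y} \<notin> E))"
    proof (rule perfectly_matched_or_co_bipartite)
      show "finite ?X" using finV by simp
      show "even (card ?X)" using cardX n by simp
      fix x y u assume *: "x \<in> ?X" "y \<in> ?X" "u \<in> ?X" "x \<noteq> y" "y \<noteq> u" "x \<noteq> u"
      show "{x, y} \<in> E \<or> {y, u} \<in> E \<or> {x, u} \<in> E"
      proof (rule ccontr)
        assume no: "\<not> ?thesis"
        then have "x \<in> ?N y" "u \<in> ?N y" using * by (auto intro!: NI simp: insert_commute)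
        then show False using tri[of y x u] * no by blast
      qed
    qed
    then obtain A B where AB: "A \<union> B = ?X" "A \<inter> B = {}" "odd (card A)" "odd (card B)"
        and non: "\<forall>x\<in>A. \<forall>y\<in>B. {x, y} \<notin> E"
      using unmatched[OF z] by metis
    have non': "{x, y} \<notin> E" if "x \<in> B" "y \<in> A" for x y using non that by (metis insert_commute)
    show ?thesis
    proof (cases "c \<in> A")
      case True
      show ?thesis by (rule sided[OF AB(1,2,4) True]) (use non in blast)
    next
      case False
      then have cB: "c \<in> B" using AB(1) cX by blast
      show ?thesis by (rule sided[of B A]) (use AB cB non' in auto)
    qed
  qed
  \<comment> \<open>Comparing the two descriptions of \<open>?N c\<close> obtained from
    \<open>z\<close> and \<open>z'\<close> gives \<open>s = z'\<close>.\<close>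
  have "card (?N a - {w}) = 2" using card3[OF V(1)] wN(1) finN by simp
  then obtain z z' where z: "?N a - {w} = {z, z'}" "z \<noteq> z'" by (meson card_2_iff)
  then have zN: "z \<in> ?N a" "z \<noteq> w" "z' \<in> ?N a" "z' \<noteq> w" by blast+
  obtain s where s: "?N c = {w, z, s}" "a \<notin> ?N s" using key[OF zN(1,2)] by blast
  obtain s' where "?N c = {w, z', s'}" using key[OF zN(3,4)] by blast
  then have "z' = s" using s(1) z(2) zN(4) by blast
  then show False using s(2) non_neighbours_sym[OF zN(3) V(1)] by simp
qed

section \<open>The choice of the deleted vertex, and the value of \<open>rd\<close>\<close>

lemma card_le_two_subset: "\<lbrakk>finite A; card A \<le> 2\<rbrakk> \<Longrightarrow> \<exists>a b. A \<subseteq> {a, b}"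
proof -
  assume "finite A" "card A \<le> 2"
  then consider "A = {}" | "card A = 1" | "card A = 2"
    by (metis One_nat_def card_0_eq le_Suc_eq le_zero_eq numeral_2_eq_2)
  then show ?thesis
  proof cases
    case 2
    then obtain a where "A = {a}" by (rule card_1_singletonE)
    then show ?thesis by blast
  qed (auto simp: card_2_iff)
qed

text \<open>Every vertex has \<open>k - 1\<close> non-neighbours. If for some vertex they lie in
  \<open>{a, b, c}\<close> with \<open>a\<close>, \<open>b\<close> non-adjacent, fans suffice.
  Otherwise the complement is cubic and triangle-free, and the matching construction
  applies.\<close>

lemma dense_regular_delete_vertex_edge_colorable:
  assumes G: "simple_graph V E" "connected_graph V E" and reg: "regular d V E"
    and n: "card V = d + k" "1 \<le> k" "k \<le> 4"
  shows "\<exists>w\<in>V. edge_colorable {e \<in> E. w \<notin> e} d"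
proof -
  let ?N = "non_neighbours V E"
  have finV: "finite V" and card2: "\<And>e. e \<in> E \<Longrightarrow> card e = 2" and sub: "\<And>e. e \<in> E \<Longrightarrow> e \<subseteq> V"
    using G(1) by (auto simp: simple_graph_def)
  have finE: "finite E" using simple_graph_finite[OF G(1)] .
  have Ed: "degree E v = d" if "v \<in> V" for v using reg that by (simp add: regular_def)
  have finN: "finite (?N v)" for v using finV by (simp add: non_neighbours_def)
  have cardN: "card (?N v) = k - 1" if "v \<in> V" for v
    using card_non_neighbours[OF G(1) that] Ed[OF that] n(1) by simp
  obtain w0 where w0: "w0 \<in> V" using G(2) by (auto simp: connected_graph_def)
  show ?thesis
  proof (cases "d = 0")
    case True
    have "E = {}"
    proof (rule ccontr)
      assume "E \<noteq> {}"
      then obtain e where e: "e \<in> E" by blast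
      then obtain x where "x \<in> e" using card2[OF e] by fastforce
      then have "0 < degree E x" "x \<in> V" using degree_pos[OF finE e] sub[OF e] by blast+
      then show False using Ed[of x] True by simp
    qed
    then show ?thesis using w0 by (auto simp: edge_colorable_empty)
  next
    case False
    show ?thesis
    proof (cases "\<exists>w\<in>V. \<exists>a b c. ?N w \<subseteq> {a, b, c} \<and> {a, b} \<notin> E")
      case True
      then show ?thesis
        using edge_colorable_delete_vertex_path_core[OF G(1) reg] \<open>d \<noteq> 0\<close> by blast
    next
      case no: False
      have k: "k = 4"
      proof (rule ccontr)
        assume "k \<noteq> 4"
        then have "card (?N w0) \<le> 2" using cardN[OF w0] n by simp
        \<comment> \<open>Two names suffice for \<open>k \<le> 3\<close>, and \<open>a, a\<close> is
          a non-adjacent pair because there are no loops.\<close>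
        then obtain a c where "?N w0 \<subseteq> {a, a, c}" using card_le_two_subset[OF finN] by fastforce
        moreover have "{a, a} \<notin> E" using card2 by fastforce
        ultimately show False using no w0 by blast
      qed
      have card3: "card (?N v) = 3" if "v \<in> V" for v using cardN[OF that] k by simp
      have tri: "{x, y} \<in> E" if "v \<in> V" "x \<in> ?N v" "y \<in> ?N v" "x \<noteq> y" for v x y
      proof -
        have "card (?N v - {x, y}) = 1"
          using card_Diff_subset[of "{x, y}" "?N v"] card3[OF that(1)] that by simp
        then obtain c where "?N v - {x, y} = {c}" by (rule card_1_singletonE)
        then have "?N v \<subseteq> {x, y, c}" by blast
        then show ?thesis using no that(1) by blast
      qed
      have "crossing E V = {}" using sub by (auto simp: crossing_def)
      \<comment> \<open>Handshake lemma: \<open>d\<close> and \<open>card V = d + 4\<close> have the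
        same parity, so an even product makes both even.\<close>
      then have "card V * d = 2 * card {e \<in> E. e \<subseteq> V}"
        using sum_degree[OF finE _ finV] card2 Ed by simp
      then have "even (card V * d)" by simp
      then have even: "even (card V)" using n(1) k by auto
      obtain a b c where abc: "?N w0 = {a, b, c}" "a \<noteq> b" "a \<noteq> c" "b \<noteq> c"
        using card3[OF w0] by (metis card_3_iff)
      \<comment> \<open>On six vertices the complement would be the complete bipartite graph on 3 +
        3 vertices, and \<open>G\<close> would not be connected.\<close>
      have "card V \<noteq> 6"
      proof
        assume six: "card V = 6"
        let ?S = "{a, b, c}"
        have SV: "?S \<subseteq> V" "w0 \<notin> ?S" unfolding abc(1)[symmetric] by (auto simp: non_neighbours_def)
        have "card ?S = 3" using abc(2-4) by simp
        then have cVS: "card (V - ?S) = 3" using card_Diff_subset[of ?S V] SV six by simp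
        have NS: "?N x = V - ?S" if "x \<in> ?S" for x
        proof (rule card_seteq)
          show "finite (V - ?S)" using finV by simp
          show "card (V - ?S) \<le> card (?N x)" using cVS card3[of x] SV that by auto
          show "?N x \<subseteq> V - ?S"
          proof
            fix u assume u: "u \<in> ?N x"
            then have "u \<in> V" "u \<noteq> x" "{x, u} \<notin> E" by (auto simp: non_neighbours_def)
            then show "u \<in> V - ?S" using tri[OF w0, of x u] that unfolding abc(1) by blast
          qed
        qed
        have "component V E a \<subseteq> ?S"
        proof (rule component_closed)
          fix x y assume xy: "{x, y} \<in> E" "x \<in> ?S"
          then have "y \<notin> V - ?S" using NS[OF xy(2)] by (auto simp: non_neighbours_def)
          then show "y \<in> ?S" using sub[OF xy(1)] by blast
        qed simp
        moreover have "component V E a = V" using G(2) SV(1) unfolding connected_graph_def by blast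
        ultimately show False using SV(2) w0 by blast
      qed
      then have d2: "2 \<le> d" and n8: "8 \<le> card V" using even n(1) k \<open>d \<noteq> 0\<close> by presburger+
      have "\<exists>z. z \<in> ?N a \<and> z \<noteq> w0 \<and> perfectly_matched E (V - {w0, z, a, b})"
        by (rule triangle_free_cubic_complement_matching[OF G(1) card3 _ even n8 w0 abc])
          (assumption, rule tri, assumption+)
      then obtain z where z: "z \<in> ?N a" "z \<noteq> w0" "perfectly_matched E (V - {w0, z, a, b})" by blast
      have aN: "a \<in> ?N w0" "b \<in> ?N w0" "c \<in> ?N w0" using abc(1) by simp_all
      have aV: "a \<in> V" using aN(1) by (simp add: non_neighbours_def)
      \<comment> \<open>\<open>w0\<close> and \<open>z\<close> are both non-neighbours of
        \<open>a\<close>, hence adjacent.\<close>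
      have "{w0, z} \<in> E" using tri[OF aV non_neighbours_sym[OF aN(1) w0] z(1)] z(2) by simp
      moreover have "{a, z} \<notin> E" using z(1) by (simp add: non_neighbours_def)
      moreover have "{a, b} \<in> E" "{a, c} \<in> E" using tri[OF w0] aN abc by simp_all
      ultimately have "edge_colorable {e \<in> E. w0 \<notin> e} d"
        using edge_colorable_delete_vertex_matching[OF G(1) reg w0 d2 abc] z(3) by blast
      then show ?thesis using w0 by blast
    qed
  qed
qed

theorem theorem6:
  fixes V :: "'a set" and E :: "'a set set" and n k :: nat
  assumes "simple_graph V E"
    and "connected_graph V E"
    and "card V = n"
    and "1 \<le> k" and "k \<le> 4" and "k \<le> n"
    and "regular (n - k) V E"
  shows "rd V E = n - k"
  unfolding rd_def
proof (rule Least_equality)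
  have "card V = n - k + k" using assms by simp
  then obtain w where "w \<in> V" "edge_colorable {e \<in> E. w \<notin> e} (n - k)"
    using dense_regular_delete_vertex_edge_colorable[OF assms(1,2,7) _ assms(4,5)] by blast
  then show "\<exists>c. c ` E \<subseteq> {1..n - k} \<and> rainbow_disconnected V E c"
    using rainbow_disconnected_of_delete_vertex[OF assms(1)] assms(7) by (simp add: regular_def)
next
  fix m assume "\<exists>c. c ` E \<subseteq> {1..m} \<and> rainbow_disconnected V E c"
  then obtain c where c: "c ` E \<subseteq> {1..m}" "rainbow_disconnected V E c" by blast
  show "n - k \<le> m"
  proof (cases "2 \<le> n")
    case True
    then show ?thesis
      using rainbow_disconnected_lower_bound[OF assms(1,2,7) _ _ c] assms(3,5) by simp
  next
    case False
    \<comment> \<open>With at most one vertex there is no pair to separate, but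
      \<open>1 \<le> k\<close> makes \<open>n - k\<close> equal to 0.\<close>
    then show ?thesis using assms(4) by simp
  qed
qed

end
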